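(* Let $n\ge2$, $\rho>0$, and let $u_0\colon B_\rho(0)\to\mathbb{R}$, $B_\rho(0)\subset\mathbb{R}^n$, be a smooth function. Suppose that there are $\alpha>1$ and $C>0$ such that $$u_0(x)\simeq C\,(\rho-|x|)^{-\alpha}\qquad(|x|\to\rho).$$ Let $(u,\Omega)$ be a mean curvature flow without singularities starting from $u_0$ (so $\Omega_0=B_\rho(0)$). Then, with $T=\frac{\rho^2}{2(n-1)}$, $$u(0,t)\simeq C\left(\rho-\sqrt{2(n-1)t}\right)^{-\alpha}\simeq C\left(\frac{n-1}{\rho}\,(T-t)\right)^{-\alpha}\qquad(t\to T).$$
   Context: $f\simeq g$ means that the quotient $f/g$ tends to $1$ in the indicated limit; $t\to T$ is from below. A mean curvature flow without singularities with initial data $(u_0,\Omega_0)$ ($\Omega_0\subset\mathbb{R}^n$ open, $u_0\colon\Omega_0\to\mathbb{R}$ locally Lipschitz with a continuous extension $\overline{u}_0\colon\mathbb{R}^n\to[-\infty,\infty]$ satisfying $\{-\infty<\overline u_0<\infty\}=\Omega_0$) is a pair $(u,\Omega)$ of a relatively open set $\Omega\subset\mathbb{R}^n\times[0,\infty)$ and a continuous function $u\colon\Omega\to\mathbb{R}$ such that: with time slices $\Omega_t$ defined by $\Omega=\bigcup_{t\ge0}\Omega_t\times\{t\}$, the zero time slice is $\Omega_0$ and $u(\cdot,0)=u_0$; (maximality) there is a continuous function $\overline u\colon\mathbb{R}^n\times[0,\infty)\to[-\infty,\infty]$ with $\{(x,t):-\infty<\overline u(x,t)<\infty\}=\Omega$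 and $\overline u|_\Omega=u$; (equation) on $\Omega\setminus(\Omega_0\times\{0\})$ the function $u$ is smooth and satisfies $\partial_tu=\left(\delta^{ij}-\frac{u^iu^j}{1+|Du|^2}\right)u_{ij}$ (summation convention). *)

theory Defs
  imports "HOL-Analysis.Analysis" "HOL-Library.Landau_Symbols"
begin

definition partial_deriv :: "'a::real_normed_vector \<Rightarrow> ('a \<Rightarrow> real) \<Rightarrow> 'a \<Rightarrow> real"
  where "partial_deriv v f x = frechet_derivative f (at x) v"

text \<open>The derivatives are taken in the full space, so the next two notions are meant for open \<open>S\<close>.\<close>

primrec Ck_on :: "nat \<Rightarrow> 'a::euclidean_space set \<Rightarrow> ('a \<Rightarrow> real) \<Rightarrow> bool"
  where
    "Ck_on 0 S f \<longleftrightarrow> continuous_on S f"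
  | "Ck_on (Suc k) S f \<longleftrightarrow>
       (\<forall>x\<in>S. f differentiable (at x)) \<and> (\<forall>b\<in>Basis. Ck_on k S (partial_deriv b f))"

definition smooth_on :: "'a::euclidean_space set \<Rightarrow> ('a \<Rightarrow> real) \<Rightarrow> bool"
  where "smooth_on S f \<longleftrightarrow> (\<forall>k. Ck_on k S f)"

definition locally_lipschitz_on :: "'a::metric_space set \<Rightarrow> ('a \<Rightarrow> real) \<Rightarrow> bool"
  where "locally_lipschitz_on S f \<longleftrightarrow> (\<forall>x\<in>S. \<exists>r>0. \<exists>L. L-lipschitz_on (ball x r \<inter> S) f)"

text \<open>Functions on a subset are total functions whose values outside the subset are irrelevant.\<close>

definition mcf_initial_data :: "(real^'n \<Rightarrow> real) \<Rightarrow> (real^'n) set \<Rightarrow> bool"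
  where "mcf_initial_data u0 \<Omega>0 \<longleftrightarrow>
    open \<Omega>0 \<and> locally_lipschitz_on \<Omega>0 u0 \<and>
    (\<exists>u0bar :: real^'n \<Rightarrow> ereal. continuous_on UNIV u0bar \<and>
       {x. -\<infinity> < u0bar x \<and> u0bar x < \<infinity>} = \<Omega>0 \<and>
       (\<forall>x\<in>\<Omega>0. u0bar x = ereal (u0 x)))"

text \<open>Space-time is \<open>(real^'n) \<times> real\<close>, the second component being time.\<close>

definition spatial_deriv :: "'n \<Rightarrow> ((real^'n) \<times> real \<Rightarrow> real) \<Rightarrow> (real^'n) \<times> real \<Rightarrow> real"
  where "spatial_deriv i = partial_deriv (axis i 1, 0)"

definition time_deriv :: "((real^'n) \<times> real \<Rightarrow> real) \<Rightarrow> (real^'n) \<times> real \<Rightarrow> real"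
  where "time_deriv = partial_deriv (0, 1)"

definition graphical_mcf_rhs :: "((real^'n) \<times> real \<Rightarrow> real) \<Rightarrow> (real^'n) \<times> real \<Rightarrow> real"
  where "graphical_mcf_rhs u z =
    (\<Sum>i\<in>UNIV. \<Sum>j\<in>UNIV.
       ((if i = j then 1 else 0) -
          spatial_deriv i u z * spatial_deriv j u z / (1 + (\<Sum>k\<in>UNIV. (spatial_deriv k u z)\<^sup>2)))
       * spatial_deriv j (spatial_deriv i u) z)"

definition time_slice :: "('a \<times> real) set \<Rightarrow> real \<Rightarrow> 'a set"
  where "time_slice \<Omega> t = {x. (x, t) \<in> \<Omega>}"

definition mcf_without_singularities ::
    "(real^'n \<Rightarrow> real) \<Rightarrow> (real^'n) set \<Rightarrow> ((real^'n) \<times> real \<Rightarrow> real) \<Rightarrow> ((real^'n) \<times> real) set \<Rightarrow> bool"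
  where "mcf_without_singularities u0 \<Omega>0 u \<Omega> \<longleftrightarrow>
    mcf_initial_data u0 \<Omega>0 \<and>
    openin (top_of_set (UNIV \<times> {0..})) \<Omega> \<and> continuous_on \<Omega> u \<and>
    time_slice \<Omega> 0 = \<Omega>0 \<and> (\<forall>x\<in>\<Omega>0. u (x, 0) = u0 x) \<and>
    (\<exists>ubar :: (real^'n) \<times> real \<Rightarrow> ereal. continuous_on (UNIV \<times> {0..}) ubar \<and>
       {z \<in> UNIV \<times> {0..}. -\<infinity> < ubar z \<and> ubar z < \<infinity>} = \<Omega> \<and>
       (\<forall>z\<in>\<Omega>. ubar z = ereal (u z))) \<and>
    smooth_on (\<Omega> - \<Omega>0 \<times> {0}) u \<and>
    (\<forall>z \<in> \<Omega> - \<Omega>0 \<times> {0}. time_deriv u z = graphical_mcf_rhs u z)"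

end

theory Submission
  imports Defs
begin

text \<open>
Near the boundary of the ball the graph of \<open>u0\<close> is almost a vertical cylinder over an \<open>(n-1)\<close>-sphere, and a
sphere of radius \<open>r\<close> moves by mean curvature so that \<open>r\<^sup>2 + 2 (n - 1) t\<close> is constant. So the level set of \<open>u0\<close> that
starts at radius \<open>r\<close> reaches the origin at about the time \<open>t = r\<^sup>2 / (2 (n - 1))\<close>, and \<open>u (0, t)\<close> should be close to the
value of \<open>u0\<close> at the radius \<open>\<surd>(2 (n - 1) t)\<close>. Since \<open>\<rho> - r\<close> behaves like \<open>(\<rho>\<^sup>2 - r\<^sup>2) / (2 \<rho>)\<close>,
this value is that of the smooth profile \<open>\<psi> s = A (\<rho>\<^sup>2 - s) powr - \<alpha>\<close> with \<open>A = C (2 \<rho>) powr \<alpha>\<close> at \<open>s = 2 (n - 1) t\<close>.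

Put \<open>N = n - 1\<close>, \<open>q = |x|\<^sup>2\<close> and \<open>s = q + 2 N t\<close>. For \<open>w = \<psi> s\<close> the time derivative minus the mean curvature operator is
\<open>- (2 \<psi>' + 4 q \<psi>'') / (1 + 4 q \<psi>'\<^sup>2)\<close>. For increasing convex \<open>\<psi>\<close> this is negative, so \<open>w\<close> is a
subsolution, and even each tangent line of \<open>\<psi>\<close> gives one. This yields the lower bound
(\<open>flow_lower_bound\<close>).

For the upper bound the error term has to be compensated. It is largest where the slope \<open>P = 2 |x| \<psi>'\<close> is at most of order one, that
is, at the tip of the graph, and there it is comparable with the speed itself. But after multiplication by \<open>|x|\<close> it is bounded,
and this is the effect of adding \<open>- c |x|\<close> to \<open>w\<close>: the operator decreases by \<open>N c / |x|\<close> from the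
tangential directions, while the radial second derivative is unchanged. The change of slope from \<open>P\<close> to \<open>P - c\<close> costs slightly
more than is gained if \<open>n = 2\<close>; a term \<open>\<epsilon> \<psi> (2 N t)\<close> covers this loss near the tip, and \<open>K t\<close> everywhere
else (\<open>blowup_inequality\<close>, \<open>blowup_barrier\<close>). The concave corner of \<open>- c |x|\<close> at the origin is harmless, as no
differentiable function touches it from below. The resulting bound is
\<open>u (0, t) \<le> (1 + \<epsilon>) \<psi> (2 N t) + k\<close> (\<open>flow_upper_bound\<close>).

Both comparisons presuppose knowledge of where the flow is infinite. It is handled as a continuous function \<open>v\<close> with extended
real values (\<open>extended_mcf\<close>); at time zero \<open>v\<close> is \<open>\<infinity>\<close> outside the ball, because the complement is
connected (\<open>infinite_outside_ball\<close>). A barrier in the shape of a capsule whose rim is vertical, and therefore moves too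
fast to be touched, shows that bounds persist on balls shrinking almost as slowly as \<open>(n-1)\<close>-spheres
(\<open>lower_bound_persists\<close>). Applied to \<open>v\<close> far away from the ball it keeps infinite values infinite,
which closes the lower comparison at its lateral boundary; applied to \<open>-v\<close> inside the ball it keeps finite values
finite for \<open>|x|\<^sup>2 + 2 N t < \<rho>\<^sup>2\<close>, which makes the upper comparison possible.
\<close>

section \<open>One-sided tests for touching functions\<close>

lemma second_derivative_test_min:
  fixes k k' :: "real \<Rightarrow> real"
  assumes k: "\<forall>\<^sub>F h in nhds 0. (k has_real_derivative k' h) (at h)"
    and k': "(k' has_real_derivative k2) (at 0)"
    and min: "\<forall>\<^sub>F h in nhds 0. k 0 \<le> k h"
  shows "k' 0 = 0" "0 \<le> k2"
proof -
  obtain e where e: "e > 0"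
    "\<And>h. \<bar>h\<bar> < e \<Longrightarrow> (k has_real_derivative k' h) (at h)" "\<And>h. \<bar>h\<bar> < e \<Longrightarrow> k 0 \<le> k h"
    using eventually_conj[OF k min] unfolding eventually_nhds_metric dist_real_def by auto
  show z: "k' 0 = 0"
    by (rule DERIV_local_min[OF e(2)[of 0] e(1)]) (use e in auto)
  show "0 \<le> k2"
  proof (rule ccontr)
    assume "\<not> 0 \<le> k2"
    then obtain d where d: "d > 0" "\<And>h. 0 < h \<Longrightarrow> h < d \<Longrightarrow> k' h < 0"
      using DERIV_neg_dec_right[OF k'] z by auto
    define h where "h = min d e / 2"
    have h: "0 < h" "h < d" "h < e" using d(1) e(1) by (auto simp: h_def)
    have "k h < k 0"
      by (rule DERIV_neg_imp_decreasing_open[OF h(1)])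
         (use h d e in \<open>force intro!: DERIV_isCont continuous_at_imp_continuous_on\<close>)+
    with e(3)[of h] h show False by auto
  qed
qed

text \<open>
At a first contact the two functions are ordered only at earlier times, so the time derivatives can
be compared in one direction only.
\<close>
lemma left_derivative_le_of_touching:
  fixes g w :: "real \<Rightarrow> real"
  assumes g: "(g has_real_derivative a) (at t)" and w: "(w has_real_derivative b) (at t)"
    and le: "\<forall>\<^sub>F s in at_left t. w s \<le> g s" and eq: "w t = g t"
  shows "a \<le> b"
proof (rule ccontr)
  assume "\<not> a \<le> b"
  moreover have "((\<lambda>s. g s - w s) has_real_derivative a - b) (at t)"
    by (intro DERIV_diff g w)
  ultimately obtain d where d: "d > 0" "\<And>h. 0 < h \<Longrightarrow> h < d \<Longrightarrow> g (t - h) - w (t - h) < g t - w t"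
    using DERIV_pos_inc_left[of "\<lambda>s. g s - w s" "a - b" t] by auto
  have "\<forall>\<^sub>F s in at_left t. t - d < s"
    using d(1) by (intro eventually_at_leftI[of "t-d"]) auto
  moreover have "\<forall>\<^sub>F s in at_left t. s < t" by (simp add: eventually_at_filter)
  ultimately have "\<forall>\<^sub>F s in at_left t. False"
    using le
  proof eventually_elim
    case (elim s) with d(2)[of "t - s"] eq show ?case by auto
  qed
  then show False by simp
qed

section \<open>Ellipticity of the mean curvature operator\<close>

text \<open>
The right-hand side of the flow equation for gradient \<open>p\<close> and Hessian \<open>H\<close>: the trace of
\<open>(I - p p\<^sup>T / (1 + |p|\<^sup>2)) H\<close>.
\<close>
definition mcf_operator :: "real^'n \<Rightarrow> real^'n^'n \<Rightarrow> real"
  where "mcf_operator p H = trace H - p \<bullet> (H *v p) / (1 + p \<bullet> p)"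

lemma mcf_operator_diff: "mcf_operator p (G - H) = mcf_operator p G - mcf_operator p H"
  by (simp add: mcf_operator_def trace_sub matrix_vector_mult_diff_rdistrib inner_diff_right diff_divide_distrib)

text \<open>
Ellipticity. The coefficient matrix \<open>I - m p p\<^sup>T\<close> with \<open>m = 1 / (1 + |p|\<^sup>2)\<close> is the square of
the symmetric matrix \<open>I - \<kappa> p p\<^sup>T\<close> for \<open>\<kappa> = m / (1 + \<surd>m)\<close>. If \<open>\<xi> i\<close> are the columns of the latter, the
operator is therefore the sum of the numbers \<open>\<xi> i \<bullet> (H *v \<xi> i)\<close>.
\<close>
lemma mcf_operator_nonneg:
  fixes p :: "real^'n"
  assumes psd: "\<And>\<xi>. 0 \<le> \<xi> \<bullet> (H *v \<xi>)"
  shows "0 \<le> mcf_operator p H"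
proof -
  define m where "m = 1 / (1 + p \<bullet> p)"
  define \<kappa> where "\<kappa> = m / (1 + sqrt m)"
  have pos: "1 + p \<bullet> p > 0" by (simp add: add_pos_nonneg)
  have m: "0 < m" and mp: "m * (p \<bullet> p) = 1 - m" using pos by (auto simp: m_def field_simps)
  define \<xi> :: "'n \<Rightarrow> real^'n" where "\<xi> i = axis i 1 - (\<kappa> * p $ i) *\<^sub>R p" for i
  have sum_axis: "(\<Sum>i\<in>UNIV. p $ i *\<^sub>R axis i 1) = p"
    using basis_expansion[of p] by (simp add: scalar_mult_eq_scaleR)
  have 1: "\<xi> i \<bullet> (H *v \<xi> i) = H $ i $ i - \<kappa> * (p $ i * (H *v p) $ i)
      - \<kappa> * (p \<bullet> (H *v (p $ i *\<^sub>R axis i 1))) + \<kappa>\<^sup>2 * (p \<bullet> (H *v p)) * (p $ i * p $ i)" for i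
  proof -
    have "axis i 1 \<bullet> (H *v axis i 1) = H $ i $ i"
      by (simp add: inner_axis' matrix_vector_mul_component inner_axis)
    then show ?thesis
      by (simp add: \<xi>_def matrix_vector_mult_diff_distrib inner_diff_left inner_diff_right
          inner_axis' scaleR_matrix_vector_assoc[symmetric] matrix_vector_mult_scaleR power2_eq_square algebra_simps)
  qed
  have "(\<Sum>i\<in>UNIV. \<xi> i \<bullet> (H *v \<xi> i)) = trace H - (2 * \<kappa> - \<kappa>\<^sup>2 * (p \<bullet> p)) * (p \<bullet> (H *v p))"
  proof -
    have a: "(\<Sum>i\<in>UNIV. p $ i * (H *v p) $ i) = p \<bullet> (H *v p)" by (simp add: inner_vec_def)
    have b: "(\<Sum>i\<in>UNIV. p \<bullet> (H *v (p $ i *\<^sub>R axis i 1))) = p \<bullet> (H *v p)"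
    proof -
      have "(\<Sum>i\<in>UNIV. p \<bullet> (H *v (p $ i *\<^sub>R axis i 1))) = p \<bullet> (H *v (\<Sum>i\<in>UNIV. p $ i *\<^sub>R axis i 1))"
        using linear_sum[OF matrix_vector_mul_linear[of H], of "\<lambda>i. p $ i *\<^sub>R axis i 1" UNIV]
        by (simp add: inner_sum_right)
      then show ?thesis by (simp only: sum_axis)
    qed
    have c: "(\<Sum>i\<in>UNIV. p $ i * p $ i) = p \<bullet> p" by (simp add: inner_vec_def)
    show ?thesis
      unfolding 1 sum.distrib sum_subtractf sum_distrib_left[symmetric] a b c trace_def
      by (simp add: algebra_simps)
  qed
  moreover have "2 * \<kappa> - \<kappa>\<^sup>2 * (p \<bullet> p) = m"
  proof -
    define q where "q = sqrt m"
    have q: "q > 0" "m = q\<^sup>2" using m by (auto simp: q_def)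
    have "m * (\<kappa>\<^sup>2 * (p \<bullet> p)) = \<kappa>\<^sup>2 * (1 - m)" unfolding mp[symmetric] by (simp add: ac_simps)
    then have "m * (2 * \<kappa> - \<kappa>\<^sup>2 * (p \<bullet> p)) = 2 * m * \<kappa> - \<kappa>\<^sup>2 * (1 - m)" by (simp add: algebra_simps)
    also have "\<dots> = m * m"
    proof -
      have k: "\<kappa> * (1 + q) = q\<^sup>2" using q by (simp add: \<kappa>_def flip: q_def)
      have "1 - q\<^sup>2 = (1 + q) * (1 - q)" by (simp add: algebra_simps power2_eq_square)
      then have "\<kappa>\<^sup>2 * (1 - q\<^sup>2) = \<kappa> * (\<kappa> * (1 + q)) * (1 - q)" by (simp add: power2_eq_square)
      also have "\<dots> = q\<^sup>2 * (2 * \<kappa> - \<kappa> * (1 + q))" unfolding k by (simp add: algebra_simps k[symmetric])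
      finally show ?thesis unfolding q(2) k by (simp add: algebra_simps power2_eq_square)
    qed
    finally show ?thesis using m by simp
  qed
  moreover have "0 \<le> (\<Sum>i\<in>UNIV. \<xi> i \<bullet> (H *v \<xi> i))" by (intro sum_nonneg psd)
  ultimately show ?thesis by (simp add: mcf_operator_def m_def)
qed

text \<open>
The left-hand side is the operator at the matrix \<open>a y y\<^sup>T + b I\<close>, the form of the Hessian of a radial function
at a point with position vector \<open>y\<close>.
\<close>
lemma mcf_operator_ge:
  fixes p y :: "real^'n"
  assumes "\<And>\<xi>. a * (y \<bullet> \<xi>)\<^sup>2 + b * (\<xi> \<bullet> \<xi>) \<le> \<xi> \<bullet> (H *v \<xi>)"
  shows "a * (y \<bullet> y) + b * real CARD('n) - (a * (p \<bullet> y)\<^sup>2 + b * (p \<bullet> p)) / (1 + p \<bullet> p)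
    \<le> mcf_operator p H"
proof -
  define G :: "real^'n^'n" where "G = (\<chi> i j. a * (y $ i * y $ j) + (if i = j then b else 0))"
  have G: "G *v \<xi> = (a * (y \<bullet> \<xi>)) *\<^sub>R y + b *\<^sub>R \<xi>" for \<xi>
  proof (rule vec_eq_iff[THEN iffD2], intro allI)
    fix i
    have "(G *v \<xi>) $ i = (\<Sum>j\<in>UNIV. a * y $ i * (y $ j * \<xi> $ j) + (if i = j then b * \<xi> $ j else 0))"
      by (auto simp: G_def matrix_vector_mult_def algebra_simps intro!: sum.cong)
    also have "\<dots> = a * y $ i * (y \<bullet> \<xi>) + b * \<xi> $ i"
      by (simp add: sum.distrib sum_distrib_left inner_vec_def)
    finally show "(G *v \<xi>) $ i = ((a * (y \<bullet> \<xi>)) *\<^sub>R y + b *\<^sub>R \<xi>) $ i" by simp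
  qed
  have "trace G = a * (y \<bullet> y) + b * real CARD('n)"
    by (simp add: trace_def G_def sum.distrib inner_vec_def sum_distrib_left)
  then have "mcf_operator p G = a * (y \<bullet> y) + b * real CARD('n) - (a * (p \<bullet> y)\<^sup>2 + b * (p \<bullet> p)) / (1 + p \<bullet> p)"
    by (simp add: mcf_operator_def G inner_add_right power2_eq_square inner_commute)
  moreover have "0 \<le> mcf_operator p (H - G)"
  proof (rule mcf_operator_nonneg)
    fix \<xi> show "0 \<le> \<xi> \<bullet> ((H - G) *v \<xi>)"
      using assms[of \<xi>]
      by (simp add: matrix_vector_mult_diff_rdistrib inner_diff_right G inner_add_right power2_eq_square inner_commute)
  qed
  ultimately show ?thesis by (simp add: mcf_operator_diff)
qed

section \<open>The flow with extended real values\<close>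

text \<open>
A second order Taylor expansion of \<open>f\<close> at \<open>x\<close>, recorded only along the straight lines through \<open>x\<close>.
The gradient \<open>p\<close> and the matrix \<open>H\<close> enter through \<open>p \<bullet> \<xi>\<close> and \<open>\<xi> \<bullet> (H *v \<xi>)\<close> alone, so comparing
with a barrier becomes the second derivative test in one variable.
\<close>
definition has_spatial_jet :: "(real^'n \<Rightarrow> real) \<Rightarrow> real^'n \<Rightarrow> real^'n \<Rightarrow> real^'n^'n \<Rightarrow> bool"
  where "has_spatial_jet f x p H \<longleftrightarrow>
    (\<forall>\<xi>. \<exists>g'. (\<forall>\<^sub>F h in nhds 0. ((\<lambda>h. f (x + h *\<^sub>R \<xi>)) has_real_derivative g' h) (at h)) \<and>
      g' 0 = p \<bullet> \<xi> \<and> (g' has_real_derivative \<xi> \<bullet> (H *v \<xi>)) (at 0))"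

text \<open>
The flow as a single function with values in the extended reals, the equation being imposed wherever the
value is finite and the time positive. In this form the boundary of the moving domain disappears from
the arguments, and, the equation being odd, upper bounds for \<open>v\<close> are lower bounds for \<open>-v\<close>.
\<close>
definition extended_mcf :: "((real^'n) \<times> real \<Rightarrow> ereal) \<Rightarrow> bool"
  where "extended_mcf v \<longleftrightarrow> continuous_on (UNIV \<times> {0..}) v \<and>
    (\<forall>x t. 0 < t \<and> \<bar>v (x, t)\<bar> \<noteq> \<infinity> \<longrightarrow> (\<exists>f p H.
       (\<forall>\<^sub>F z in nhds (x, t). v z = ereal (f z)) \<and> has_spatial_jet (\<lambda>y. f (y, t)) x p H \<and>
       ((\<lambda>s. f (x, s)) has_real_derivative mcf_operator p H) (at t)))"

lemma has_spatial_jet_uminus: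
  assumes "has_spatial_jet f x p H"
  shows "has_spatial_jet (\<lambda>y. - f y) x (- p) (- H)"
  unfolding has_spatial_jet_def
proof
  fix \<xi>
  obtain g' where g': "\<forall>\<^sub>F h in nhds 0. ((\<lambda>h. f (x + h *\<^sub>R \<xi>)) has_real_derivative g' h) (at h)"
      "g' 0 = p \<bullet> \<xi>" "(g' has_real_derivative \<xi> \<bullet> (H *v \<xi>)) (at 0)"
    using assms unfolding has_spatial_jet_def by blast
  have "\<forall>\<^sub>F h in nhds 0. ((\<lambda>h. - f (x + h *\<^sub>R \<xi>)) has_real_derivative - g' h) (at h)"
    using g'(1) by eventually_elim (rule DERIV_minus)
  moreover have "- H *v \<xi> = - (H *v \<xi>)"
    using matrix_vector_mult_diff_rdistrib[of 0 H \<xi>] by simp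
  then have "((\<lambda>h. - g' h) has_real_derivative \<xi> \<bullet> (- H *v \<xi>)) (at 0)"
    using DERIV_minus[OF g'(3)] by simp
  ultimately show "\<exists>g'. (\<forall>\<^sub>F h in nhds 0. ((\<lambda>h. - f (x + h *\<^sub>R \<xi>)) has_real_derivative g' h) (at h)) \<and>
      g' 0 = - p \<bullet> \<xi> \<and> (g' has_real_derivative \<xi> \<bullet> (- H *v \<xi>)) (at 0)"
    using g'(2) by (intro exI[of _ "\<lambda>h. - g' h"]) simp
qed

lemma extended_mcf_uminus:
  assumes "extended_mcf v"
  shows "extended_mcf (\<lambda>z. - v z)"
  unfolding extended_mcf_def
proof (intro conjI allI impI)
  show "continuous_on (UNIV \<times> {0..}) (\<lambda>z. - v z)"
    using assms unfolding extended_mcf_def by (intro continuous_on_compose2[OF continuous_uminus_ereal]) auto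
  fix x t assume "0 < t \<and> \<bar>- v (x, t)\<bar> \<noteq> \<infinity>"
  then have "0 < t \<and> \<bar>v (x, t)\<bar> \<noteq> \<infinity>" by simp
  from assms[unfolded extended_mcf_def, THEN conjunct2, rule_format, OF this]
  obtain f p H where f: "\<forall>\<^sub>F z in nhds (x, t). v z = ereal (f z)"
      "has_spatial_jet (\<lambda>y. f (y, t)) x p H"
      "((\<lambda>s. f (x, s)) has_real_derivative mcf_operator p H) (at t)" by blast
  have "\<forall>\<^sub>F z in nhds (x, t). - v z = ereal (- f z)"
    using f(1) by eventually_elim simp
  moreover have "((\<lambda>s. - f (x, s)) has_real_derivative mcf_operator (- p) (- H)) (at t)"
  proof -
    have m: "- H *v - p = H *v p"
      using matrix_vector_mult_diff_rdistrib[of 0 H "- p"] matrix_vector_mult_diff_distrib[of H 0 p] by simp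
    have "mcf_operator (- p) (- H) = - mcf_operator p H"
      using trace_sub[of 0 H] unfolding mcf_operator_def m by (simp add: trace_def)
    then show ?thesis using DERIV_minus[OF f(3)] by simp
  qed
  ultimately show "\<exists>f p H. (\<forall>\<^sub>F z in nhds (x, t). - v z = ereal (f z)) \<and>
      has_spatial_jet (\<lambda>y. f (y, t)) x p H \<and>
      ((\<lambda>s. f (x, s)) has_real_derivative mcf_operator p H) (at t)"
    using has_spatial_jet_uminus[OF f(2)]
    by (intro exI[of _ "\<lambda>z. - f z"] exI[of _ "- p"] exI[of _ "- H"]) simp
qed

section \<open>From a graphical flow to its extended-real form\<close>

lemma spatial_line_derivative:
  fixes f :: "(real^'n) \<times> real \<Rightarrow> real"
  assumes "f differentiable at (x + h *\<^sub>R \<xi>, t)"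
  shows "((\<lambda>h. f (x + h *\<^sub>R \<xi>, t)) has_real_derivative
    (\<Sum>i\<in>UNIV. spatial_deriv i f (x + h *\<^sub>R \<xi>, t) * \<xi> $ i)) (at h)"
proof -
  let ?z = "(x + h *\<^sub>R \<xi>, t)"
  let ?L = "frechet_derivative f (at ?z)"
  have L: "(f has_derivative ?L) (at ?z)" using assms by (simp add: frechet_derivative_works)
  then have lin: "linear ?L" by (rule has_derivative_linear)
  have "((\<lambda>h. (x + h *\<^sub>R \<xi>, t)) has_derivative (\<lambda>k. (k *\<^sub>R \<xi>, 0))) (at h)"
    by (auto intro!: derivative_eq_intros)
  from diff_chain_at[OF this, of f ?L] L
  have "((\<lambda>h. f (x + h *\<^sub>R \<xi>, t)) has_derivative (\<lambda>k. ?L (k *\<^sub>R \<xi>, 0))) (at h)"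
    by (simp add: o_def)
  moreover have "?L (k *\<^sub>R \<xi>, 0) = (\<Sum>i\<in>UNIV. spatial_deriv i f ?z * \<xi> $ i) * k" for k
  proof -
    have "(k *\<^sub>R \<xi>, 0::real) = k *\<^sub>R (\<Sum>i\<in>UNIV. \<xi> $ i *\<^sub>R (axis i 1, 0))"
    proof (rule prod_eqI)
      show "fst (k *\<^sub>R \<xi>, 0::real) = fst (k *\<^sub>R (\<Sum>i\<in>UNIV. \<xi> $ i *\<^sub>R (axis i 1, 0::real)))"
        using basis_expansion[of \<xi>] by (simp add: fst_sum scalar_mult_eq_scaleR)
    qed (simp add: snd_sum)
    then have "?L (k *\<^sub>R \<xi>, 0) = k * (\<Sum>i\<in>UNIV. \<xi> $ i * ?L (axis i 1, 0))"
      by (simp only: linear_cmul[OF lin] linear_sum[OF lin] real_scaleR_def)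
    then show ?thesis by (simp add: spatial_deriv_def partial_deriv_def mult.commute)
  qed
  ultimately show ?thesis by (simp add: has_field_derivative_def)
qed

lemma time_line_derivative:
  fixes f :: "(real^'n) \<times> real \<Rightarrow> real"
  assumes "f differentiable at (x, t)"
  shows "((\<lambda>s. f (x, s)) has_real_derivative time_deriv f (x, t)) (at t)"
proof -
  let ?L = "frechet_derivative f (at (x, t))"
  have L: "(f has_derivative ?L) (at (x, t))" using assms by (simp add: frechet_derivative_works)
  then have lin: "linear ?L" by (rule has_derivative_linear)
  have "((\<lambda>s. (x, s)) has_derivative (\<lambda>k. (0, k))) (at t)"
    by (auto intro!: derivative_eq_intros)
  from diff_chain_at[OF this, of f ?L] L
  have "((\<lambda>s. f (x, s)) has_derivative (\<lambda>k. ?L (0, k))) (at t)"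
    by (simp add: o_def)
  moreover have "?L (0, k) = time_deriv f (x, t) * k" for k
    using linear_cmul[OF lin, of k "(0, 1)"] by (simp add: time_deriv_def partial_deriv_def)
  ultimately show ?thesis by (simp add: has_field_derivative_def)
qed

lemma graphical_mcf_rhs_eq_operator:
  "graphical_mcf_rhs u z = mcf_operator (\<chi> i. spatial_deriv i u z) (\<chi> i j. spatial_deriv j (spatial_deriv i u) z)"
proof -
  let ?p = "\<lambda>i. spatial_deriv i u z" and ?H = "\<lambda>i j. spatial_deriv j (spatial_deriv i u) z"
  have "graphical_mcf_rhs u z = (\<Sum>i\<in>UNIV. \<Sum>j\<in>UNIV. (if i = j then ?H i j else 0)
      - ?p i * (?H i j * ?p j) / (1 + (\<Sum>k\<in>UNIV. ?p k * ?p k)))"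
    unfolding graphical_mcf_rhs_def by (intro sum.cong refl) (auto simp: algebra_simps power2_eq_square)
  also have "\<dots> = mcf_operator (\<chi> i. ?p i) (\<chi> i j. ?H i j)"
    by (simp add: mcf_operator_def sum_subtractf trace_def inner_vec_def matrix_vector_mult_def
        sum_distrib_left sum_divide_distrib)
  finally show ?thesis .
qed

text \<open>
At positive times the domain is open in the full space-time, so the derivatives in the equation are ordinary
derivatives and restrict to lines.
\<close>
lemma mcf_extension:
  assumes "mcf_without_singularities u0 \<Omega>0 u \<Omega>"
  obtains v where "extended_mcf v" "\<And>x. x \<in> \<Omega>0 \<Longrightarrow> v (x, 0) = ereal (u0 x)"
    "\<And>x. x \<notin> \<Omega>0 \<Longrightarrow> \<bar>v (x, 0)\<bar> = \<infinity>"
    "\<And>x t. 0 \<le> t \<Longrightarrow> \<bar>v (x, t)\<bar> \<noteq> \<infinity> \<Longrightarrow> (x, t) \<in> \<Omega> \<and> v (x, t) = ereal (u (x, t))"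
proof -
  from assms obtain v where oi: "openin (top_of_set (UNIV \<times> {0..})) \<Omega>"
    and sl: "time_slice \<Omega> 0 = \<Omega>0" and ini: "\<And>x. x \<in> \<Omega>0 \<Longrightarrow> u (x, 0) = u0 x"
    and cont: "continuous_on (UNIV \<times> {0..}) v"
    and dom: "{z \<in> UNIV \<times> {0..}. -\<infinity> < v z \<and> v z < \<infinity>} = \<Omega>"
    and vu: "\<And>z. z \<in> \<Omega> \<Longrightarrow> v z = ereal (u z)"
    and sm: "smooth_on (\<Omega> - \<Omega>0 \<times> {0}) u"
    and eq: "\<And>z. z \<in> \<Omega> - \<Omega>0 \<times> {0} \<Longrightarrow> time_deriv u z = graphical_mcf_rhs u z"
    unfolding mcf_without_singularities_def by blast
  have fin: "(x, t) \<in> \<Omega> \<longleftrightarrow> 0 \<le> t \<and> \<bar>v (x, t)\<bar> \<noteq> \<infinity>" for x t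
    unfolding dom[symmetric] by auto
  define S where "S = \<Omega> \<inter> (UNIV \<times> {0<..})"
  have S: "S = \<Omega> - \<Omega>0 \<times> {0}"
  proof -
    have "(x, 0) \<in> \<Omega> \<longleftrightarrow> x \<in> \<Omega>0" for x using sl by (auto simp: time_slice_def)
    moreover have "(x, t) \<in> \<Omega> \<Longrightarrow> 0 \<le> t" for x t using fin by simp
    ultimately show ?thesis by (fastforce simp: S_def)
  qed
  have opS: "open S"
  proof -
    from oi obtain O1 where "open O1" "\<Omega> = (UNIV \<times> {0..}) \<inter> O1" by (auto simp: openin_open)
    then have "S = O1 \<inter> (UNIV \<times> {0<..})" by (auto simp: S_def)
    then show ?thesis using \<open>open O1\<close> by (auto intro!: open_Int open_Times)
  qed
  have C2: "Ck_on (Suc (Suc 0)) S u" using sm unfolding smooth_on_def S by blast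
  have basis: "(axis i 1, 0) \<in> (Basis :: ((real^'a) \<times> real) set)" for i
    by (simp add: Basis_prod_def axis_in_Basis_iff)
  have d1: "u differentiable at z" if "z \<in> S" for z using C2 that by simp
  have d2: "spatial_deriv i u differentiable at z" if "z \<in> S" for z i
    using C2 that basis[of i] unfolding spatial_deriv_def by simp
  show ?thesis
  proof (rule that[of v])
    show "v (x, 0) = ereal (u0 x)" if "x \<in> \<Omega>0" for x
      using that vu[of "(x, 0)"] ini[of x] sl by (auto simp: time_slice_def)
    show "\<bar>v (x, 0)\<bar> = \<infinity>" if "x \<notin> \<Omega>0" for x
      using that fin[of x 0] sl by (auto simp: time_slice_def)
    show "(x, t) \<in> \<Omega> \<and> v (x, t) = ereal (u (x, t))" if "0 \<le> t" "\<bar>v (x, t)\<bar> \<noteq> \<infinity>" for x t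
    proof
      show "(x, t) \<in> \<Omega>" unfolding fin by (rule conjI) fact+
      then show "v (x, t) = ereal (u (x, t))" by (rule vu)
    qed
    show "extended_mcf v"
      unfolding extended_mcf_def
    proof (intro conjI allI impI cont)
      fix x t assume t: "0 < t \<and> \<bar>v (x, t)\<bar> \<noteq> \<infinity>"
      then have zS: "(x, t) \<in> S" using fin by (auto simp: S_def)
      define p where "p = (\<chi> i. spatial_deriv i u (x, t))"
      define H where "H = (\<chi> i j. spatial_deriv j (spatial_deriv i u) (x, t))"
      have "\<forall>\<^sub>F z in nhds (x, t). v z = ereal (u z)"
        using eventually_nhds_in_open[OF opS zS] by eventually_elim (auto simp: vu S_def)
      moreover have "((\<lambda>s. u (x, s)) has_real_derivative mcf_operator p H) (at t)"
        using time_line_derivative[OF d1[OF zS]] eq[of "(x, t)"] zS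
        unfolding S p_def H_def graphical_mcf_rhs_eq_operator by simp
      moreover have "has_spatial_jet (\<lambda>y. u (y, t)) x p H"
        unfolding has_spatial_jet_def
      proof
        fix \<xi>
        define g' where "g' h = (\<Sum>i\<in>UNIV. spatial_deriv i u (x + h *\<^sub>R \<xi>, t) * \<xi> $ i)" for h
        have "((\<lambda>h. (x + h *\<^sub>R \<xi>, t)) \<longlongrightarrow> (x + 0 *\<^sub>R \<xi>, t)) (nhds 0)"
          by (intro tendsto_intros filterlim_ident)
        then have "\<forall>\<^sub>F h in nhds 0. (x + h *\<^sub>R \<xi>, t) \<in> S"
          using topological_tendstoD[OF _ opS] zS by fastforce
        then have "\<forall>\<^sub>F h in nhds 0. ((\<lambda>h. u (x + h *\<^sub>R \<xi>, t)) has_real_derivative g' h) (at h)"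
          by eventually_elim (simp add: g'_def d1 spatial_line_derivative)
        moreover have "g' 0 = p \<bullet> \<xi>" by (simp add: g'_def p_def inner_vec_def)
        moreover have "(g' has_real_derivative \<xi> \<bullet> (H *v \<xi>)) (at 0)"
        proof -
          have "(g' has_real_derivative (\<Sum>i\<in>UNIV. (\<Sum>j\<in>UNIV.
              spatial_deriv j (spatial_deriv i u) (x + 0 *\<^sub>R \<xi>, t) * \<xi> $ j) * \<xi> $ i)) (at 0)"
            unfolding g'_def
            by (intro DERIV_sum DERIV_cmult_right spatial_line_derivative) (simp add: d2 zS)
          moreover have "\<xi> \<bullet> (H *v \<xi>) = (\<Sum>i\<in>UNIV. (\<Sum>j\<in>UNIV.
              spatial_deriv j (spatial_deriv i u) (x, t) * \<xi> $ j) * \<xi> $ i)"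
            by (simp add: H_def inner_vec_def matrix_vector_mult_def mult.commute[of "\<xi> $ _"])
          ultimately show ?thesis by simp
        qed
        ultimately show "\<exists>g'. (\<forall>\<^sub>F h in nhds 0. ((\<lambda>h. u (x + h *\<^sub>R \<xi>, t)) has_real_derivative g' h) (at h)) \<and>
            g' 0 = p \<bullet> \<xi> \<and> (g' has_real_derivative \<xi> \<bullet> (H *v \<xi>)) (at 0)" by blast
      qed
      ultimately show "\<exists>f p H. (\<forall>\<^sub>F z in nhds (x, t). v z = ereal (f z)) \<and>
          has_spatial_jet (\<lambda>y. f (y, t)) x p H \<and>
          ((\<lambda>s. f (x, s)) has_real_derivative mcf_operator p H) (at t)" by blast
    qed
  qed
qed

section \<open>Contact with radial barriers\<close>

lemma extended_mcf_jet:
  assumes "extended_mcf v" "0 < t" "\<bar>v (x, t)\<bar> \<noteq> \<infinity>"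
  obtains f g p H where "\<forall>\<^sub>F y in nhds x. v (y, t) = ereal (f y)" "has_spatial_jet f x p H"
    "\<forall>\<^sub>F s in nhds t. v (x, s) = ereal (g s)" "(g has_real_derivative mcf_operator p H) (at t)"
proof -
  from assms(1)[unfolded extended_mcf_def, THEN conjunct2, rule_format, OF conjI[OF assms(2,3)]]
  obtain f p H where f: "\<forall>\<^sub>F z in nhds (x, t). v z = ereal (f z)"
      "has_spatial_jet (\<lambda>y. f (y, t)) x p H"
      "((\<lambda>s. f (x, s)) has_real_derivative mcf_operator p H) (at t)" by blast
  have "filterlim (\<lambda>y. (y, t)) (nhds (x, t)) (nhds x)" "filterlim (\<lambda>s. (x, s)) (nhds (x, t)) (nhds t)"
    by (intro tendsto_intros filterlim_ident)+
  from f(1)[THEN eventually_compose_filterlim, OF this(1)] f(1)[THEN eventually_compose_filterlim, OF this(2)]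
  show ?thesis using f(2,3) by (intro that[of "\<lambda>y. f (y, t)" p H "\<lambda>s. f (x, s)"])
qed

text \<open>
The comparison principle at a single point. A radial function \<open>F (|x - x0|\<^sup>2)\<close> has gradient \<open>2 F' y\<close> and
Hessian \<open>2 F' I + 4 F'' y y\<^sup>T\<close> with \<open>y = x - x0\<close>, so the left-hand side of the conclusion is its mean
curvature operator. A barrier whose time derivative \<open>D\<close> is smaller than that cannot touch the flow from
below. The barrier is described by its slice \<open>F\<close> at time \<open>t\<close> and its trace \<open>G\<close> over \<open>x\<close> separately,
since the test uses nothing but these two restrictions.
\<close>
lemma radial_touching_from_below:
  fixes x x0 :: "real^'n"
  assumes v: "extended_mcf v" and t: "0 < t"
    and eq: "v (x, t) = ereal (F ((norm (x - x0))\<^sup>2))"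
    and space: "\<forall>\<^sub>F y in nhds x. ereal (F ((norm (y - x0))\<^sup>2)) \<le> v (y, t)"
    and time: "\<forall>\<^sub>F s in at_left t. ereal (G s) \<le> v (x, s)"
    and Gt: "G t = F ((norm (x - x0))\<^sup>2)" and G: "(G has_real_derivative D) (at t)"
    and q: "q = (norm (x - x0))\<^sup>2"
    and F: "\<forall>\<^sub>F r in nhds q. (F has_real_derivative F' r) (at r)"
    and F': "(F' has_real_derivative F2) (at q)"
  shows "2 * (real CARD('n) - 1) * F' q + (2 * F' q + 4 * q * F2) / (1 + 4 * q * (F' q)\<^sup>2) \<le> D"
proof -
  from eq have "\<bar>v (x, t)\<bar> \<noteq> \<infinity>" by simp
  from extended_mcf_jet[OF v t this] obtain f g p H
    where f: "\<forall>\<^sub>F y in nhds x. v (y, t) = ereal (f y)" "has_spatial_jet f x p H"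
      and g: "\<forall>\<^sub>F s in nhds t. v (x, s) = ereal (g s)" "(g has_real_derivative mcf_operator p H) (at t)" .
  define y where "y = x - x0"
  have qy: "q = y \<bullet> y" by (simp add: q y_def dot_square_norm)
  have fx: "f x = F q" using eventually_nhds_x_imp_x[OF f(1)] eq q by simp
  have "mcf_operator p H \<le> D"
  proof (rule left_derivative_le_of_touching[OF g(2) G])
    show "G t = g t" using eventually_nhds_x_imp_x[OF g(1)] eq Gt by simp
    have "\<forall>\<^sub>F s in at_left t. v (x, s) = ereal (g s)"
      using g(1) by (auto simp: eventually_at_filter elim: eventually_mono)
    with time show "\<forall>\<^sub>F s in at_left t. G s \<le> g s" by eventually_elim simp
  qed
  have jet: "p \<bullet> \<xi> = F' q * (2 * (y \<bullet> \<xi>)) \<and>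
      F2 * (2 * (y \<bullet> \<xi>))\<^sup>2 + F' q * (2 * (\<xi> \<bullet> \<xi>)) \<le> \<xi> \<bullet> (H *v \<xi>)" for \<xi>
  proof -
    obtain g' where g': "\<forall>\<^sub>F h in nhds 0. ((\<lambda>h. f (x + h *\<^sub>R \<xi>)) has_real_derivative g' h) (at h)"
        "g' 0 = p \<bullet> \<xi>" "(g' has_real_derivative \<xi> \<bullet> (H *v \<xi>)) (at 0)"
      using f(2) unfolding has_spatial_jet_def by blast
    define Q where "Q h = q + 2 * h * (y \<bullet> \<xi>) + h\<^sup>2 * (\<xi> \<bullet> \<xi>)" for h :: real
    have Q: "(norm (x + h *\<^sub>R \<xi> - x0))\<^sup>2 = Q h" for h
    proof -
      have "x + h *\<^sub>R \<xi> - x0 = y + h *\<^sub>R \<xi>" by (simp add: y_def)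
      then have "(norm (x + h *\<^sub>R \<xi> - x0))\<^sup>2 = (y + h *\<^sub>R \<xi>) \<bullet> (y + h *\<^sub>R \<xi>)"
        by (simp only: power2_norm_eq_inner)
      then show ?thesis
        by (simp add: Q_def qy inner_add_left inner_add_right inner_commute power2_eq_square algebra_simps)
    qed
    have Q': "(Q has_real_derivative 2 * (y \<bullet> \<xi>) + 2 * h * (\<xi> \<bullet> \<xi>)) (at h)" for h
      unfolding Q_def by (auto intro!: derivative_eq_intros)
    define k where "k h = f (x + h *\<^sub>R \<xi>) - F (Q h)" for h
    define k' where "k' h = g' h - F' (Q h) * (2 * (y \<bullet> \<xi>) + 2 * h * (\<xi> \<bullet> \<xi>))" for h
    have Q0: "Q 0 = q" by (simp add: Q_def)
    have "(Q \<longlongrightarrow> Q 0) (nhds 0)"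
      using DERIV_isCont[OF Q'[of 0]] by (simp add: continuous_at tendsto_nhds_iff)
    then have "\<forall>\<^sub>F h in nhds 0. (F has_real_derivative F' (Q h)) (at (Q h))"
      using eventually_compose_filterlim[OF F] Q0 by simp
    with g'(1) have k: "\<forall>\<^sub>F h in nhds 0. (k has_real_derivative k' h) (at h)"
    proof eventually_elim
      case (elim h)
      show ?case unfolding k_def k'_def
        by (rule DERIV_diff[OF elim(1) DERIV_chain2[OF elim(2) Q']])
    qed
    have k2: "(k' has_real_derivative (\<xi> \<bullet> (H *v \<xi>) - (F2 * (2 * (y \<bullet> \<xi>)) * (2 * (y \<bullet> \<xi>)) + F' q * (2 * (\<xi> \<bullet> \<xi>))))) (at 0)"
    proof -
      have "((\<lambda>h. F' (Q h)) has_real_derivative F2 * (2 * (y \<bullet> \<xi>))) (at 0)"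
        using DERIV_chain2[of F' F2 Q 0, OF _ Q'[of 0]] F' Q0 by simp
      then show ?thesis unfolding k'_def
        by (auto intro!: derivative_eq_intros g'(3) simp: Q0)
    qed
    have "((\<lambda>h. x + h *\<^sub>R \<xi>) \<longlongrightarrow> x + 0 *\<^sub>R \<xi>) (nhds 0)" by (intro tendsto_intros filterlim_ident)
    then have lim: "filterlim (\<lambda>h. x + h *\<^sub>R \<xi>) (nhds x) (nhds 0)" by simp
    have kmin: "\<forall>\<^sub>F h in nhds 0. k 0 \<le> k h"
      using eventually_compose_filterlim[OF space lim] eventually_compose_filterlim[OF f(1) lim]
      by eventually_elim (simp add: k_def Q Q0 fx)
    from second_derivative_test_min[OF k k2 kmin] g'(2) show ?thesis
      by (simp add: k'_def Q0 power2_eq_square algebra_simps)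
  qed
  have p: "p = (2 * F' q) *\<^sub>R y"
    by (rule vector_eq_rdot[THEN iffD1]) (use jet in auto)
  have "(4 * F2) * (y \<bullet> y) + (2 * F' q) * real CARD('n)
      - ((4 * F2) * (p \<bullet> y)\<^sup>2 + (2 * F' q) * (p \<bullet> p)) / (1 + p \<bullet> p) \<le> mcf_operator p H"
    by (rule mcf_operator_ge) (use jet in \<open>simp add: power_mult_distrib algebra_simps\<close>)
  also have "(4 * F2) * (y \<bullet> y) + (2 * F' q) * real CARD('n)
      - ((4 * F2) * (p \<bullet> y)\<^sup>2 + (2 * F' q) * (p \<bullet> p)) / (1 + p \<bullet> p) =
      2 * (real CARD('n) - 1) * F' q + (2 * F' q + 4 * q * F2) / (1 + 4 * q * (F' q)\<^sup>2)"
  proof -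
    have "1 + 4 * q * (F' q)\<^sup>2 > 0" by (simp add: q add_pos_nonneg)
    then show ?thesis
      unfolding p by (simp add: qy[symmetric] field_simps power2_eq_square)
  qed
  finally show ?thesis using \<open>mcf_operator p H \<le> D\<close> by simp
qed

text \<open>
The barriers below contain a term \<open>c |x - x0|\<close>, which is not differentiable at the centre. Its corner points
downwards, and a differentiable function lying above it cannot meet it at the corner: along a line, the
derivative of the difference to the smooth part of the barrier would be at least \<open>c\<close> on one side and at most \<open>-c\<close> on the other.
\<close>
lemma convex_kink_cannot_touch:
  fixes x :: "real^'n"
  assumes v: "extended_mcf v" and t: "0 < t" and c: "0 < c"
    and eq: "v (x, t) = ereal (F 0)"
    and space: "\<forall>\<^sub>F y in nhds x. ereal (F ((norm (y - x))\<^sup>2) + c * norm (y - x)) \<le> v (y, t)"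
    and F: "(F has_real_derivative F') (at 0)"
  shows False
proof -
  from eq have "\<bar>v (x, t)\<bar> \<noteq> \<infinity>" by simp
  from extended_mcf_jet[OF v t this] obtain f p H
    where f: "\<forall>\<^sub>F y in nhds x. v (y, t) = ereal (f y)" "has_spatial_jet f x p H" by metis
  obtain i :: 'n where True by simp
  define \<xi> :: "real^'n" where "\<xi> = axis i 1"
  have n: "norm \<xi> = 1" by (simp add: \<xi>_def)
  obtain g' where g': "\<forall>\<^sub>F h in nhds 0. ((\<lambda>h. f (x + h *\<^sub>R \<xi>)) has_real_derivative g' h) (at h)"
    using f(2) unfolding has_spatial_jet_def by blast
  define k where "k h = f (x + h *\<^sub>R \<xi>) - F (h\<^sup>2)" for h :: real
  have "((\<lambda>h. F (h\<^sup>2)) has_real_derivative 0) (at 0)"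
    using DERIV_chain2[of F F' "\<lambda>h. h\<^sup>2" 0 0 UNIV] DERIV_pow[of 2 0] F by simp
  then have k': "(k has_real_derivative g' 0) (at 0)"
    using DERIV_diff[OF eventually_nhds_x_imp_x[OF g']] unfolding k_def by force
  have "((\<lambda>h. x + h *\<^sub>R \<xi>) \<longlongrightarrow> x + 0 *\<^sub>R \<xi>) (nhds 0)" by (intro tendsto_intros filterlim_ident)
  then have lim: "filterlim (\<lambda>h. x + h *\<^sub>R \<xi>) (nhds x) (nhds 0)" by simp
  have "f x = F 0" using eventually_nhds_x_imp_x[OF f(1)] eq by simp
  have ge: "\<forall>\<^sub>F h in nhds 0. k 0 + c * \<bar>h\<bar> \<le> k h"
    using eventually_compose_filterlim[OF space lim] eventually_compose_filterlim[OF f(1) lim]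
  proof eventually_elim
    case (elim h)
    then show ?case using n \<open>f x = F 0\<close> by (simp add: k_def)
  qed
  have 1: "- c \<ge> g' 0"
  proof (rule left_derivative_le_of_touching[OF k'])
    show "((\<lambda>h. k 0 - c * h) has_real_derivative - c) (at 0)" by (auto intro!: derivative_eq_intros)
    have "\<forall>\<^sub>F h in at_left 0. k 0 + c * \<bar>h\<bar> \<le> k h"
      using ge by (auto simp: eventually_at_filter elim: eventually_mono)
    moreover have "\<forall>\<^sub>F h in at_left 0. h < (0::real)" by (simp add: eventually_at_filter)
    ultimately show "\<forall>\<^sub>F h in at_left 0. k 0 - c * h \<le> k h" by eventually_elim simp
  qed simp
  have "\<forall>\<^sub>F h in nhds 0. k 0 \<le> k h" 
    using ge
  proof eventually_elim
    case (elim h)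
    moreover have "0 \<le> c * \<bar>h\<bar>" using c by simp
    ultimately show ?case by linarith
  qed
  then obtain d where "d > 0" "\<And>h. \<bar>h\<bar> < d \<Longrightarrow> k 0 \<le> k h"
    unfolding eventually_nhds_metric dist_real_def by auto
  then have "g' 0 = 0" by (intro DERIV_local_min[OF k']) auto
  with 1 c show False by simp
qed

text \<open>
A first contact happens where \<open>v\<close> is finite, since it takes the value of the real function \<open>w\<close> there; so
\<open>v\<close> may be infinite elsewhere. The set \<open>K\<close> contains with each point the earlier points above the same
\<open>x\<close>, so at the first time where \<open>v \<le> w\<close> occurs, continuity from the past gives \<open>w \<le> v\<close> on the whole
time slice of \<open>K\<close>, and hence equality at the point of contact.
\<close>
lemma first_touching:
  fixes K :: "((real^'n) \<times> real) set"
  assumes K: "compact K" "K \<subseteq> UNIV \<times> {0..}"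
    and past: "\<And>x t s. (x, t) \<in> K \<Longrightarrow> 0 \<le> s \<Longrightarrow> s \<le> t \<Longrightarrow> (x, s) \<in> K"
    and v: "continuous_on (UNIV \<times> {0..}) v" and w: "continuous_on K w"
    and init: "\<And>x. (x, 0) \<in> K \<Longrightarrow> ereal (w (x, 0)) < v (x, 0)"
    and notouch: "\<And>x t. (x, t) \<in> K \<Longrightarrow> 0 < t \<Longrightarrow> v (x, t) = ereal (w (x, t)) \<Longrightarrow>
      (\<And>y s. (y, s) \<in> K \<Longrightarrow> s \<le> t \<Longrightarrow> ereal (w (y, s)) \<le> v (y, s)) \<Longrightarrow> False"
    and z: "z \<in> K"
  shows "ereal (w z) < v z"
proof (rule ccontr)
  assume "\<not> ereal (w z) < v z"
  define Z where "Z = {z \<in> K. v z \<le> ereal (w z)}"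
  have vK: "continuous_on K v" using v K(2) by (rule continuous_on_subset)
  have wK: "continuous_on K (\<lambda>z. ereal (w z))" by (intro continuous_on_ereal w)
  have "compact Z"
  proof -
    have le: "closed {p :: ereal \<times> ereal. fst p \<le> snd p}"
      by (intro closed_Collect_le continuous_intros)
    have "closed (K \<inter> (\<lambda>z. (v z, ereal (w z))) -` {p. fst p \<le> snd p})"
      by (rule continuous_closed_preimage)
         (use le K(1) vK wK in \<open>auto intro!: continuous_on_Pair simp: compact_imp_closed\<close>)
    moreover have "K \<inter> (\<lambda>z. (v z, ereal (w z))) -` {p. fst p \<le> snd p} = Z" by (auto simp: Z_def)
    ultimately have "closed Z" by simp
    moreover have "Z = K \<inter> Z" by (auto simp: Z_def)
    ultimately show ?thesis using K(1) compact_Int_closed[of K Z] by simp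
  qed
  moreover have "z \<in> Z" using \<open>\<not> _\<close> z by (simp add: Z_def not_less)
  then have "Z \<noteq> {}" by blast
  ultimately have "\<exists>z0\<in>Z. \<forall>z\<in>Z. snd z0 \<le> snd z"
    by (intro continuous_attains_inf continuous_intros)
  then obtain z0 where z0: "z0 \<in> Z" "\<And>z. z \<in> Z \<Longrightarrow> snd z0 \<le> snd z" by metis
  obtain x t where xt: "z0 = (x, t)" by (cases z0)
  have xK: "(x, t) \<in> K" and le: "v (x, t) \<le> ereal (w (x, t))" using z0(1) by (auto simp: Z_def xt)
  have "0 \<le> t" using xK K(2) by auto
  moreover have "t \<noteq> 0" using init[of x] xK le by auto
  ultimately have t: "0 < t" by simp
  have before: "ereal (w (y, s)) < v (y, s)" if "(y, s) \<in> K" "s < t" for y s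
    using z0(2)[of "(y, s)"] that by (force simp: Z_def xt)
  have upto: "ereal (w (y, t)) \<le> v (y, t)" if y: "(y, t) \<in> K" for y
  proof (rule tendsto_le[of "at_left t"])
    have sub: "(y, s) \<in> K" if "s \<in> {0..t}" for s using past[OF y] that by auto
    have c: "((\<lambda>s. (y, s)) \<longlongrightarrow> (y, t)) (at t within {0..<t})" by (intro tendsto_intros)
    have L: "at t within {0..<t} = at_left t"
      using at_within_Icc_at_left[OF t] t
      by (intro at_within_nhd[of t "{0<..}"]) auto
    have F: "filterlim (\<lambda>s. (y, s)) (at (y, t) within K) (at_left t)"
      unfolding L[symmetric]
      using c sub by (auto simp: filterlim_at eventually_at_filter intro!: eventuallyI)
    show "((\<lambda>s. v (y, s)) \<longlongrightarrow> v (y, t)) (at_left t)"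
      using vK[unfolded continuous_on_def] y F by (auto intro: filterlim_compose)
    show "((\<lambda>s. ereal (w (y, s))) \<longlongrightarrow> ereal (w (y, t))) (at_left t)"
      using wK[unfolded continuous_on_def] y F by (auto intro: filterlim_compose)
    show "\<forall>\<^sub>F s in at_left t. ereal (w (y, s)) \<le> v (y, s)"
      unfolding L[symmetric] using sub before by (auto simp: eventually_at_filter intro!: eventuallyI less_imp_le)
  qed simp
  have "v (x, t) = ereal (w (x, t))" using upto[OF xK] le by simp
  moreover have "ereal (w (y, s)) \<le> v (y, s)" if "(y, s) \<in> K" "s \<le> t" for y s
    using before[of y s] upto[of y] that by (cases "s = t") (auto intro: less_imp_le)
  ultimately show False using notouch[OF xK t] by blast
qed

section \<open>Two scalar inequalities for barriers\<close>

lemma le_half_one_plus_square: "e \<le> (1 + e\<^sup>2) / 2" for e :: real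
  using sum_squares_bound[of e 1] by simp

text \<open>
The inequality that makes \<open>a + b \<surd>(R\<^sup>2 - |x|\<^sup>2 - \<sigma> t) + c |x|\<close> a strict subsolution, with \<open>P = b |x| / \<surd>(R\<^sup>2 - |x|\<^sup>2 - \<sigma> t)\<close>,
\<open>N = n - 1\<close> and \<open>\<delta> = \<sigma> - 2 N > 0\<close>. The quotient is critical near \<open>P = c\<close>, where it exceeds \<open>c\<close> by about
\<open>1 / (4 c)\<close>; there the surplus speed contributes \<open>\<delta> P / 2\<close>, about \<open>\<delta> c / 2\<close>, which wins once \<open>c\<close> is large compared
with \<open>1 / \<delta>\<close>. A large \<open>b\<close> makes the cubic term harmless.
\<close>
lemma capsule_inequality:
  fixes P \<delta> c b N :: real
  assumes \<delta>: "0 < \<delta>" and c: "c = 2 + 4 / \<delta>" and b: "b\<^sup>2 = 16 * c\<^sup>2 / \<delta>" and P: "0 < P" and N: "1 \<le> N"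
  shows "(P + P ^ 3 / b\<^sup>2) / (1 + (P - c)\<^sup>2) < N * c + \<delta> * P / 2"
proof -
  define D where "D = 1 + (P - c)\<^sup>2"
  have c2: "2 < c" and \<delta>c: "4 < \<delta> * c" using \<delta> by (auto simp: c field_simps)
  have D1: "1 \<le> D" by (simp add: D_def)
  have b0: "0 < b\<^sup>2" using \<delta> c2 by (simp add: b)
  have "P + P ^ 3 / b\<^sup>2 < (c + \<delta> * P / 2) * D"
  proof (cases "2 * c \<le> P")
    case True
    have "(P / 2)\<^sup>2 \<le> (P - c)\<^sup>2" using True P by (intro power_mono) auto
    then have D: "P\<^sup>2 / 4 \<le> D" by (simp add: D_def power_divide)
    have "P * 4 < P * (c * P)"
    proof -
      have "2 * 2 < c * P" using c2 True by (intro mult_strict_mono) auto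
      then show ?thesis using P by simp
    qed
    then have 1: "P < c * (P\<^sup>2 / 4)" by (simp add: power2_eq_square algebra_simps)
    have "1 / b\<^sup>2 \<le> \<delta> / 8"
    proof -
      have "1 * 1 \<le> c\<^sup>2 * 2" using c2 by (intro mult_mono) (auto simp: one_le_power)
      then show ?thesis using \<delta> c2 by (simp add: b field_simps)
    qed
    from mult_left_mono[OF this, of "P ^ 3"] P
    have 2: "P ^ 3 / b\<^sup>2 \<le> \<delta> * P / 2 * (P\<^sup>2 / 4)" by (simp add: power3_eq_cube power2_eq_square field_simps)
    from 1 2 have "P + P ^ 3 / b\<^sup>2 < (c + \<delta> * P / 2) * (P\<^sup>2 / 4)" by (simp add: algebra_simps)
    also have "\<dots> \<le> (c + \<delta> * P / 2) * D" using D \<delta> c2 P by (intro mult_left_mono) auto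
    finally show ?thesis .
  next
    case False
    have "P\<^sup>2 \<le> (2 * c)\<^sup>2" using False P by (intro power_mono) auto
    then have "P\<^sup>2 / b\<^sup>2 \<le> \<delta> / 4" using \<delta> c2 by (simp add: b power_mult_distrib field_simps)
    from mult_left_mono[OF this, of P] P have 1: "P ^ 3 / b\<^sup>2 \<le> \<delta> * P / 4"
      by (simp add: power3_eq_cube power2_eq_square field_simps)
    have pos: "0 < \<delta> * P" using \<delta> P by simp
    show ?thesis
    proof (cases "P \<le> c")
      case True
      have "P + P ^ 3 / b\<^sup>2 < c + \<delta> * P / 2" using 1 True pos by linarith
      also have "\<dots> \<le> (c + \<delta> * P / 2) * D" using D1 c2 pos by (simp add: mult_le_cancel_left1)
      finally show ?thesis .
    next
      case False
      have "P - c \<le> D / 2" unfolding D_def by (rule le_half_one_plus_square)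
      moreover have "c \<le> c * D" using D1 c2 by (simp add: mult_le_cancel_left1)
      moreover define X where "X = \<delta> * P * D"
      have "4 < \<delta> * P" using \<delta>c False \<delta> by (smt (verit) mult_strict_left_mono)
      then have "4 * D < X" using D1 by (simp add: X_def)
      moreover have "\<delta> * P \<le> X" using D1 pos by (simp add: X_def mult_le_cancel_left1)
      ultimately have "P + P ^ 3 / b\<^sup>2 < c * D + X / 2" using 1 D1 by argo
      then show ?thesis by (simp add: X_def algebra_simps)
    qed
  qed
  then have "(P + P ^ 3 / b\<^sup>2) / D < c + \<delta> * P / 2" using D1 by (simp add: field_simps)
  moreover have "c \<le> N * c" using N c2 by simp
  ultimately show ?thesis by (simp add: D_def)
qed

text \<open>
The inequality behind the upper barrier. Here \<open>y\<close> is the distance to blow-up in the variable \<open>|x|\<^sup>2 + 2 N t\<close>,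
\<open>r = |x|\<close>, and \<open>P\<close> is the slope of the profile. For \<open>P \<le> c\<close> the quotient is essentially at most \<open>c\<close>, and for
\<open>P \<ge> 2 c\<close> it is small. In between it may exceed \<open>c\<close> by up to \<open>1 / 2\<close>. If \<open>r\<^sup>2 \<le> y\<close>, the \<open>\<epsilon>\<close>-term is a fixed
multiple of \<open>P > c\<close> and covers this excess for large \<open>c\<close>; if \<open>r\<^sup>2 > y\<close>, boundedness of \<open>P\<close> keeps \<open>r\<close> away from
zero and \<open>K r\<close> covers it. The second order
term \<open>2 \<beta> r\<^sup>2 / y\<close> is always at most a multiple of \<open>P r\<close>, so its contribution is absorbed by \<open>K r\<close> too.
\<close>
lemma blowup_inequality:
  fixes B \<beta> \<epsilon> \<rho> :: real
  assumes B: "0 < B" and \<beta>: "1 \<le> \<beta>" and \<epsilon>: "0 < \<epsilon>" and \<rho>: "0 < \<rho>"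
  obtains c K where "0 < c" "0 < K"
    "\<And>r y P. \<lbrakk>0 < r; 0 < y; y + r\<^sup>2 \<le> \<rho>\<^sup>2; P = 2 * r * B * y powr - \<beta>\<rbrakk> \<Longrightarrow>
      P * (1 + 2 * \<beta> * r\<^sup>2 / y) / (1 + (P - c)\<^sup>2) < c + 2 * \<epsilon> * r * B * (y + r\<^sup>2) powr - \<beta> + K * r"
proof -
  define L where "L = \<rho>\<^sup>2 powr (\<beta> - 1)"
  define c where "c = 2 + 2 powr \<beta> / \<epsilon>"
  define K where "K = 8 * c\<^sup>2 * \<beta> * L / B"
  have c2: "2 < c" using \<epsilon> by (simp add: c_def)
  have L: "0 < L" using \<rho> by (simp add: L_def)
  have K: "0 < K" using c2 \<beta> L B by (simp add: K_def)
  show ?thesis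
  proof (rule that[of c K])
    show "0 < c" "0 < K" using c2 K by auto
    fix r y P :: real
    assume r: "0 < r" and y: "0 < y" and yr: "y + r\<^sup>2 \<le> \<rho>\<^sup>2" and P: "P = 2 * r * B * y powr - \<beta>"
    define D where "D = 1 + (P - c)\<^sup>2"
    define S where "S = 2 * \<epsilon> * r * B * (y + r\<^sup>2) powr - \<beta>"
    have D1: "1 \<le> D" by (simp add: D_def)
    have "0 < y + r\<^sup>2" using y by (simp add: add_pos_nonneg)
    then have S0: "0 < S" using \<epsilon> r B by (simp add: S_def)
    have P0: "0 < P" using r B y by (simp add: P)
    \<comment> \<open>Since \<open>y powr (\<beta> - 1) \<le> L\<close>, the factor \<open>1 / y\<close> of the second order term is at most a multiple of \<open>P / r\<close>.\<close>
    have "y \<le> \<rho>\<^sup>2" using yr zero_le_power2[of r] by linarith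
    then have "y powr (\<beta> - 1) \<le> L" unfolding L_def using \<beta> y by (intro powr_mono2) auto
    moreover have "y powr - \<beta> * y powr (\<beta> - 1) = 1 / y"
    proof -
      have "y powr - \<beta> * y powr (\<beta> - 1) = y powr (- \<beta> + (\<beta> - 1))" by (simp only: powr_add)
      also have "\<dots> = y powr - 1" by simp
      also have "\<dots> = 1 / y" using y by (simp add: powr_minus_divide)
      finally show ?thesis .
    qed
    ultimately have "1 / y \<le> y powr - \<beta> * L"
      by (metis mult_left_mono powr_ge_zero)
    then have "r * (1 / y) \<le> r * (y powr - \<beta> * L)" using r by (intro mult_left_mono) auto
    also have "\<dots> = P * L / (2 * B)" using B by (simp add: P)
    finally have ry: "r / y \<le> P * L / (2 * B)" by simp
    have Q: "2 * \<beta> * r\<^sup>2 / y \<le> \<beta> * L * P / B * r"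
      using mult_left_mono[OF ry, of "2 * \<beta> * r"] \<beta> r by (simp add: power2_eq_square field_simps)
    have "P * (1 + 2 * \<beta> * r\<^sup>2 / y) < (c + S + K * r) * D"
    proof (cases "2 * c \<le> P")
      case True
      have "(P / 2)\<^sup>2 \<le> (P - c)\<^sup>2" using True P0 c2 by (intro power_mono) auto
      then have D: "P\<^sup>2 / 4 \<le> D" by (simp add: D_def power_divide)
      have "2 * 2 < c * P" using c2 True by (intro mult_strict_mono) auto
      then have 1: "P < c * (P\<^sup>2 / 4)" using P0 by (simp add: power2_eq_square)
      have "4 * \<beta> * L / B \<le> K"
      proof -
        have "1 \<le> c\<^sup>2" using c2 by (simp add: one_le_power)
        then have "4 * (\<beta> * L / B) \<le> 8 * c\<^sup>2 * (\<beta> * L / B)"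
          using \<beta> L B by (intro mult_right_mono) auto
        then show ?thesis by (simp add: K_def)
      qed
      then have K4: "4 * \<beta> * L / B * (P\<^sup>2 / 4 * r) \<le> K * (P\<^sup>2 / 4 * r)" using r by (intro mult_right_mono) auto
      have "P * (2 * \<beta> * r\<^sup>2 / y) \<le> P * (\<beta> * L * P / B * r)" using Q P0 by (intro mult_left_mono) auto
      also have "\<dots> = 4 * \<beta> * L / B * (P\<^sup>2 / 4 * r)" by (simp add: power2_eq_square)
      also note K4
      finally have "P * (2 * \<beta> * r\<^sup>2 / y) \<le> K * r * (P\<^sup>2 / 4)" by (simp add: ac_simps)
      with 1 have "P * (1 + 2 * \<beta> * r\<^sup>2 / y) < (c + K * r) * (P\<^sup>2 / 4)" by (simp add: algebra_simps)
      also have "\<dots> \<le> (c + S + K * r) * D" using D S0 c2 K r by (intro mult_mono) auto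
      finally show ?thesis .
    next
      case False
      have "P * (2 * \<beta> * r\<^sup>2 / y) \<le> P * (\<beta> * L * P / B * r)" using Q P0 by (intro mult_left_mono) auto
      also have "\<dots> = P\<^sup>2 * (\<beta> * L / B * r)" by (simp add: power2_eq_square)
      also have "\<dots> \<le> (2 * c)\<^sup>2 * (\<beta> * L / B * r)"
        using False P0 \<beta> L B r by (intro mult_right_mono power_mono) auto
      also have "\<dots> = K * r / 2" by (simp add: K_def power_mult_distrib)
      finally have 2: "P * (1 + 2 * \<beta> * r\<^sup>2 / y) \<le> P + K * r / 2" by (simp add: algebra_simps)
      have Kr: "0 < K * r" using K r by simp
      show ?thesis
      proof (cases "P \<le> c")
        case True
        have "P * (1 + 2 * \<beta> * r\<^sup>2 / y) < c + S + K * r" using 2 True S0 Kr by linarith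
        also have "\<dots> \<le> (c + S + K * r) * D" using D1 c2 S0 Kr by (simp add: mult_le_cancel_left1)
        finally show ?thesis .
      next
        case gt: False
        have "1 / 2 \<le> S + K * r / 2"
        proof (cases "r\<^sup>2 \<le> y")
          case True
          have "(2 * y) powr - \<beta> \<le> (y + r\<^sup>2) powr - \<beta>"
            using True y \<beta> by (intro powr_mono2') (auto intro: add_pos_nonneg)
          then have "2 * \<epsilon> * r * B * (2 * y) powr - \<beta> \<le> S"
            unfolding S_def using \<epsilon> r B by (intro mult_left_mono) auto
          moreover have "2 * \<epsilon> * r * B * (2 * y) powr - \<beta> = \<epsilon> * 2 powr - \<beta> * P"
            using y by (simp add: P powr_mult)
          moreover have "\<epsilon> * 2 powr - \<beta> * c \<le> \<epsilon> * 2 powr - \<beta> * P"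
            using gt \<epsilon> by (intro mult_left_mono) auto
          moreover have "\<epsilon> * 2 powr - \<beta> * c = 2 * \<epsilon> * 2 powr - \<beta> + 1"
            using \<epsilon> by (simp add: c_def field_simps powr_minus)
          moreover have "0 < 2 * \<epsilon> * 2 powr - \<beta>" using \<epsilon> by simp
          ultimately show ?thesis using Kr by linarith
        next
          case False
          have "r \<le> P * L / (2 * B) * y" using ry y by (simp add: field_simps)
          also have "\<dots> \<le> P * L / (2 * B) * r\<^sup>2" using False P0 L B by (intro mult_left_mono) auto
          also have "\<dots> \<le> 2 * c * L / (2 * B) * r\<^sup>2"
            using \<open>\<not> 2 * c \<le> P\<close> L B by (intro mult_right_mono divide_right_mono) auto
          finally have "r * 1 \<le> r * (c * L / B * r)" by (simp add: power2_eq_square ac_simps)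
          then have "1 \<le> c * L / B * r" using r by (simp only: mult_le_cancel_left_pos)
          then have "4 * c * \<beta> * 1 \<le> 4 * c * \<beta> * (c * L / B * r)" using c2 \<beta> by (intro mult_left_mono) auto
          moreover have "\<dots> = K * r / 2" by (simp add: K_def power2_eq_square)
          moreover have "1 \<le> c * \<beta>" using mult_mono[of 1 c 1 \<beta>] c2 \<beta> by simp
          ultimately show ?thesis using S0 by linarith
        qed
        then have "D / 2 + K * r / 2 * D \<le> (S + K * r) * D"
          using mult_right_mono[of "1 / 2" "S + K * r / 2" D] D1 by (simp add: algebra_simps)
        moreover have "P - c \<le> D / 2" unfolding D_def by (rule le_half_one_plus_square)
        moreover have "c < c * D"
          using gt c2 by (simp add: D_def)
        moreover have "K * r / 2 \<le> K * r / 2 * D" using D1 Kr by (simp add: mult_le_cancel_left1)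
        ultimately have "P * (1 + 2 * \<beta> * r\<^sup>2 / y) < c * D + (S + K * r) * D" using 2 by linarith
        then show ?thesis by (simp add: algebra_simps)
      qed
    qed
    moreover have "0 < D" using D1 by simp
    ultimately have "P * (1 + 2 * \<beta> * r\<^sup>2 / y) / D < c + S + K * r" by (simp only: pos_divide_less_eq)
    then show "P * (1 + 2 * \<beta> * r\<^sup>2 / y) / (1 + (P - c)\<^sup>2)
        < c + 2 * \<epsilon> * r * B * (y + r\<^sup>2) powr - \<beta> + K * r"
      by (simp only: D_def S_def)
  qed
qed

section \<open>Persistence of bounds and of infinite values\<close>

lemma compact_parabolic_cap:
  fixes x0 :: "real^'n"
  assumes "0 < \<sigma>"
  shows "compact {z :: (real^'n) \<times> real. 0 \<le> snd z \<and> (norm (fst z - x0))\<^sup>2 + \<sigma> * snd z \<le> S}"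
    (is "compact ?K")
proof (cases "0 \<le> S")
  case False
  have "?K = {}"
  proof (rule equals0I)
    fix z assume "z \<in> ?K"
    moreover have "0 \<le> (norm (fst z - x0))\<^sup>2" by simp
    moreover have "0 \<le> \<sigma> * snd z" using \<open>z \<in> ?K\<close> assms by simp
    ultimately show False using False by simp
  qed
  then show ?thesis by (simp only: compact_empty)
next
  case True
  have "closed ?K" by (intro closed_Collect_conj closed_Collect_le continuous_intros)
  moreover have "?K \<subseteq> cball x0 (sqrt S) \<times> {0..S / \<sigma>}"
  proof
    fix z assume z: "z \<in> ?K"
    then have "0 \<le> \<sigma> * snd z" using assms by simp
    moreover have "0 \<le> (norm (fst z - x0))\<^sup>2" by (rule zero_le_power2)
    moreover have "(norm (fst z - x0))\<^sup>2 + \<sigma> * snd z \<le> S" using z by simp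
    ultimately have "(norm (fst z - x0))\<^sup>2 \<le> S" "\<sigma> * snd z \<le> S" by linarith+
    then have "norm (fst z - x0) \<le> sqrt S" "snd z \<le> S / \<sigma>"
      using assms by (auto simp: real_le_rsqrt field_simps)
    then show "z \<in> cball x0 (sqrt S) \<times> {0..S / \<sigma>}"
      using z by (simp add: mem_Times_iff dist_norm norm_minus_commute[of x0 "fst z"])
  qed
  then have "?K \<inter> (cball x0 (sqrt S) \<times> {0..S / \<sigma>}) = ?K" by (rule Int_absorb2)
  moreover have "compact (?K \<inter> (cball x0 (sqrt S) \<times> {0..S / \<sigma>}))"
    using \<open>closed ?K\<close> by (rule closed_Int_compact) (intro compact_Times compact_cball compact_Icc)
  ultimately show ?thesis by (simp only:)
qed

lemma eventually_near_in_cap: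
  fixes x :: "real^'n"
  assumes "(norm (x - x0))\<^sup>2 < S"
  shows "\<forall>\<^sub>F y in nhds x. (norm (y - x0))\<^sup>2 \<le> S"
proof -
  have "open {y. (norm (y - x0))\<^sup>2 < S}" by (intro open_Collect_less continuous_intros)
  then have "\<forall>\<^sub>F y in nhds x. y \<in> {y. (norm (y - x0))\<^sup>2 < S}"
    using assms by (intro eventually_nhds_in_open) auto
  then show ?thesis by eventually_elim simp
qed

lemma eventually_at_left_Ico: "a < t \<Longrightarrow> \<forall>\<^sub>F s in at_left t. a < s \<and> s < (t::real)"
  by (auto simp: eventually_at_left intro: exI[of _ a])

text \<open>
The trace in time of the flow is differentiable, so it cannot stay above a function that comes down to it
with infinite speed. This excludes contact at the rim of a barrier that ends with a vertical slope, and so makes it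
possible to use barriers on compact sets that carry no information on the lateral boundary.
\<close>
lemma infinite_speed_cannot_touch:
  fixes x :: "real^'n"
  assumes v: "extended_mcf v" and t: "0 < t" and k: "0 < k"
    and eq: "v (x, t) = ereal a"
    and time: "\<forall>\<^sub>F s in at_left t. ereal (a + k * sqrt (t - s)) \<le> v (x, s)"
  shows False
proof -
  from eq have "\<bar>v (x, t)\<bar> \<noteq> \<infinity>" by simp
  from extended_mcf_jet[OF v t this] obtain g m where
    g: "\<forall>\<^sub>F s in nhds t. v (x, s) = ereal (g s)" "(g has_real_derivative m) (at t)" by metis
  \<comment> \<open>Close to \<open>t\<close> the square root lies above the line of slope \<open>-M\<close>, for every \<open>M\<close>.\<close>
  define M where "M = \<bar>m\<bar> + 1"
  have M: "0 < M" by (simp add: M_def)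
  have "m \<le> - M"
  proof (rule left_derivative_le_of_touching[OF g(2)])
    show "((\<lambda>s. a + M * (t - s)) has_real_derivative - M) (at t)" by (auto intro!: derivative_eq_intros)
    show "a + M * (t - t) = g t" using eventually_nhds_x_imp_x[OF g(1)] eq by simp
    have "\<forall>\<^sub>F s in at_left t. v (x, s) = ereal (g s)"
      using g(1) by (auto simp: eventually_at_filter elim: eventually_mono)
    moreover have "\<forall>\<^sub>F s in at_left t. t - (k / M)\<^sup>2 < s \<and> s < t"
      using k M by (intro eventually_at_left_Ico) simp
    ultimately show "\<forall>\<^sub>F s in at_left t. a + M * (t - s) \<le> g s" using time
    proof eventually_elim
      case (elim s)
      have "sqrt (t - s) \<le> k / M" using elim k M by (intro real_le_lsqrt) auto
      then have "M * sqrt (t - s) * sqrt (t - s) \<le> k * sqrt (t - s)"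
        using elim M by (intro mult_right_mono) (auto simp: field_simps)
      then have "M * (t - s) \<le> k * sqrt (t - s)" using elim by (simp add: mult.assoc)
      with elim show ?case by simp
    qed
  qed
  then show False by (simp add: M_def)
qed

lemma DERIV_inverse_sqrt:
  fixes r :: real
  assumes "0 < r"
  shows "((\<lambda>r. inverse (sqrt r)) has_real_derivative - 1 / (2 * (r * sqrt r))) (at r)"
proof -
  define h where "h = sqrt r"
  have h: "0 < h" "r = h\<^sup>2" using assms by (auto simp: h_def)
  have "((\<lambda>r. inverse (sqrt r)) has_real_derivative - (inverse h * (inverse h / 2) * inverse h)) (at r)"
    unfolding h_def using assms by (intro DERIV_inverse' DERIV_real_sqrt) auto
  also have "- (inverse h * (inverse h / 2) * inverse h) = - 1 / (2 * (r * sqrt r))"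
    using h by (simp add: field_simps power2_eq_square)
  finally show ?thesis .
qed

text \<open>
A lower bound on a ball of radius \<open>R\<close> survives, up to a loss \<open>D\<close> that does not depend on the bound, on the ball
that shrinks at any rate above that of an \<open>(n-1)\<close>-dimensional sphere. The rate is what matters: a spherical cap
as barrier would shrink like an \<open>n\<close>-dimensional sphere. The barrier used here is a long capsule with
vertical rim, and letting \<open>M\<close> tend to infinity shows that infinite values persist as well.
\<close>
lemma lower_bound_persists:
  fixes x0 :: "real^'n"
  assumes v: "extended_mcf v" and n: "2 \<le> CARD('n)" and R: "0 < R" and \<sigma>: "2 * (real CARD('n) - 1) < \<sigma>"
  obtains D where "\<And>M x t. (\<And>y. y \<in> cball x0 R \<Longrightarrow> ereal M < v (y, 0)) \<Longrightarrow> 0 \<le> t \<Longrightarrow>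
    (norm (x - x0))\<^sup>2 + \<sigma> * t \<le> R\<^sup>2 \<Longrightarrow> ereal (M - D) < v (x, t)"
proof -
  define N where "N = real CARD('n) - 1"
  define \<delta> where "\<delta> = \<sigma> - 2 * N"
  define c where "c = 2 + 4 / \<delta>"
  define b where "b = 4 * c / sqrt \<delta>"
  have N: "1 \<le> N" using n by (simp add: N_def)
  have \<delta>: "0 < \<delta>" using \<sigma> by (simp add: \<delta>_def N_def)
  have \<sigma>0: "0 < \<sigma>" using N \<delta> by (simp add: \<delta>_def)
  have c: "0 < c" using \<delta> by (simp add: c_def add_pos_pos)
  have b: "0 < b" "b\<^sup>2 = 16 * c\<^sup>2 / \<delta>" using \<delta> c by (auto simp: b_def power_divide power_mult_distrib)
  show ?thesis
  proof (rule that[of "(b + c) * R"])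
    fix M x t
    assume M: "\<And>y. y \<in> cball x0 R \<Longrightarrow> ereal M < v (y, 0)" and t0: "0 \<le> t"
      and xt: "(norm (x - x0))\<^sup>2 + \<sigma> * t \<le> R\<^sup>2"
    define K where "K = {z :: (real^'n) \<times> real. 0 \<le> snd z \<and> (norm (fst z - x0))\<^sup>2 + \<sigma> * snd z \<le> R\<^sup>2}"
    define a where "a = M - (b + c) * R"
    define w :: "(real^'n) \<times> real \<Rightarrow> real" where
      "w z = a + b * sqrt (R\<^sup>2 - (norm (fst z - x0))\<^sup>2 - \<sigma> * snd z) + c * norm (fst z - x0)" for z
    have "ereal (w (x, t)) < v (x, t)"
    proof (rule first_touching[where K = K and v = v])
      show "compact K" unfolding K_def by (rule compact_parabolic_cap[OF \<sigma>0])
      show "K \<subseteq> UNIV \<times> {0..}" by (auto simp: K_def)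
      show "continuous_on (UNIV \<times> {0..}) v" using v by (simp add: extended_mcf_def)
      show "continuous_on K w" unfolding w_def by (intro continuous_intros)
      show "(x, t) \<in> K" using t0 xt by (simp add: K_def)
      show "(y, s) \<in> K" if "(y, t) \<in> K" "0 \<le> s" "s \<le> t" for y t s
      proof -
        have "\<sigma> * s \<le> \<sigma> * t" using that \<sigma>0 by simp
        then show ?thesis using that by (simp add: K_def)
      qed
      show "ereal (w (y, 0)) < v (y, 0)" if "(y, 0) \<in> K" for y
      proof -
        have y: "norm (y - x0) \<le> R" using that R by (auto simp: K_def power2_le_iff_abs_le)
        have "sqrt (R\<^sup>2 - (norm (y - x0))\<^sup>2) \<le> R" using R by (intro real_le_lsqrt) auto
        then have "b * sqrt (R\<^sup>2 - (norm (y - x0))\<^sup>2) + c * norm (y - x0) \<le> b * R + c * R"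
          using y b c by (intro add_mono mult_left_mono) auto
        then have "w (y, 0) \<le> M" by (simp add: w_def a_def algebra_simps)
        moreover have "ereal M < v (y, 0)" using y by (intro M) (simp add: dist_norm norm_minus_commute)
        ultimately show ?thesis by (meson ereal_less_eq(3) le_less_trans)
      qed
      show False if K: "(x, t) \<in> K" and t: "0 < t" and eq: "v (x, t) = ereal (w (x, t))"
        and le: "\<And>y s. (y, s) \<in> K \<Longrightarrow> s \<le> t \<Longrightarrow> ereal (w (y, s)) \<le> v (y, s)" for x t
      proof -
        define q where "q = (norm (x - x0))\<^sup>2"
        define Y where "Y = R\<^sup>2 - \<sigma> * t"
        have qY: "q \<le> Y" using K by (simp add: K_def q_def Y_def)
        have "\<forall>\<^sub>F s in at_left t. 0 < s \<and> s < t" using t by (rule eventually_at_left_Ico)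
        then have time: "\<forall>\<^sub>F s in at_left t. ereal (w (x, s)) \<le> v (x, s)"
        proof eventually_elim
          case (elim s)
          then have "\<sigma> * s \<le> \<sigma> * t" using \<sigma>0 by simp
          then show ?case using elim K by (intro le) (auto simp: K_def)
        qed
        show False
        proof (cases "q = Y")
          case True
          have W: "w (x, s) = w (x, t) + b * sqrt \<sigma> * sqrt (t - s)" for s
          proof -
            have "R\<^sup>2 - q - \<sigma> * s = \<sigma> * (t - s)" using True by (simp add: Y_def algebra_simps)
            then have "w (x, s) = a + b * sqrt (\<sigma> * (t - s)) + c * norm (x - x0)" by (simp add: w_def q_def)
            moreover have "w (x, t) = a + c * norm (x - x0)" using True by (simp add: w_def q_def Y_def)
            ultimately show ?thesis by (simp add: real_sqrt_mult)
          qed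
          show False
            by (rule infinite_speed_cannot_touch[OF v t _ eq, of "b * sqrt \<sigma>"])
               (use b \<sigma>0 time in \<open>simp_all only: W[symmetric] mult_pos_pos real_sqrt_gt_zero\<close>)
        next
          case False
          with qY have qY: "q < Y" by simp
          have "\<forall>\<^sub>F y in nhds x. (norm (y - x0))\<^sup>2 \<le> Y"
            using qY by (intro eventually_near_in_cap) (simp add: q_def)
          then have space: "\<forall>\<^sub>F y in nhds x. ereal (w (y, t)) \<le> v (y, t)"
            by eventually_elim (use t in \<open>auto intro!: le simp: K_def Y_def\<close>)
          show False
          proof (cases "q = 0")
            case True
            then have x: "x = x0" by (simp add: q_def)
            show False
            proof (rule convex_kink_cannot_touch[OF v t c, where F = "\<lambda>q. a + b * sqrt (Y - q)" and x = x])
              show "v (x, t) = ereal (a + b * sqrt (Y - 0))" using eq by (simp add: w_def x Y_def)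
              show "\<forall>\<^sub>F y in nhds x. ereal (a + b * sqrt (Y - (norm (y - x))\<^sup>2) + c * norm (y - x)) \<le> v (y, t)"
                using space by (simp add: w_def x Y_def algebra_simps)
              show "((\<lambda>q. a + b * sqrt (Y - q)) has_real_derivative b * (- inverse (sqrt Y) / 2)) (at 0)"
                using qY True by (auto intro!: derivative_eq_intros simp: field_simps)
            qed
          next
            case False
            then have q: "0 < q" by (simp add: q_def)
            define F' where "F' r = - b / 2 * inverse (sqrt (Y - r)) + c / 2 * inverse (sqrt r)" for r
            define F2 where "F2 = - b / 2 * (- 1 / (2 * ((Y - q) * sqrt (Y - q))) * (- 1)) + c / 2 * (- 1 / (2 * (q * sqrt q)))"
            define r where "r = sqrt q"
            define h where "h = sqrt (Y - q)"
            have r: "0 < r" "q = r\<^sup>2" using q by (auto simp: r_def)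
            have h: "0 < h" "Y - q = h\<^sup>2" using qY by (auto simp: h_def)
            have "2 * (real CARD('n) - 1) * F' q + (2 * F' q + 4 * q * F2) / (1 + 4 * q * (F' q)\<^sup>2)
                \<le> - \<sigma> * b / (2 * h)"
            proof (rule radial_touching_from_below[OF v t, where x = x and ?x0.0 = x0
                  and F = "\<lambda>q. a + b * sqrt (Y - q) + c * sqrt q" and G = "\<lambda>s. w (x, s)"])
              show "v (x, t) = ereal (a + b * sqrt (Y - (norm (x - x0))\<^sup>2) + c * sqrt ((norm (x - x0))\<^sup>2))"
                by (simp add: eq w_def Y_def algebra_simps)
              show "w (x, t) = a + b * sqrt (Y - (norm (x - x0))\<^sup>2) + c * sqrt ((norm (x - x0))\<^sup>2)"
                by (simp add: w_def Y_def algebra_simps)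
              show "\<forall>\<^sub>F y in nhds x. ereal (a + b * sqrt (Y - (norm (y - x0))\<^sup>2) + c * sqrt ((norm (y - x0))\<^sup>2)) \<le> v (y, t)"
                using space by (simp add: w_def Y_def algebra_simps)
              show "((\<lambda>s. w (x, s)) has_real_derivative - \<sigma> * b / (2 * h)) (at t)"
                unfolding w_def using qY h
                by (auto intro!: derivative_eq_intros simp: q_def[symmetric] h_def Y_def field_simps)
              have "\<forall>\<^sub>F r in nhds q. r \<in> {0<..<Y}" using q qY by (intro eventually_nhds_in_open) auto
              then show "\<forall>\<^sub>F r in nhds q. ((\<lambda>q. a + b * sqrt (Y - q) + c * sqrt q) has_real_derivative F' r) (at r)"
                by eventually_elim (auto intro!: derivative_eq_intros simp: F'_def field_simps)
              show "(F' has_real_derivative F2) (at q)"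
              proof -
                have "((\<lambda>r. inverse (sqrt (Y - r))) has_real_derivative - 1 / (2 * ((Y - q) * sqrt (Y - q))) * (- 1)) (at q)"
                  using qY by (intro DERIV_chain2[OF DERIV_inverse_sqrt]) (auto intro!: derivative_eq_intros)
                then show ?thesis unfolding F'_def F2_def
                  by (intro DERIV_add DERIV_cmult DERIV_inverse_sqrt q)
              qed
            qed (use time in \<open>auto simp: q_def\<close>)
            moreover define P where "P = b * r / h"
            have P0: "0 < P" using b r h by (simp add: P_def)
            have F'q: "F' q = (c - P) / (2 * r)"
              using r h by (simp add: F'_def P_def h_def[symmetric] r_def[symmetric] field_simps)
            have e1: "4 * q * (F' q)\<^sup>2 = (P - c)\<^sup>2"
            proof -
              have "4 * r\<^sup>2 * ((c - P) / (2 * r))\<^sup>2 = (P - c)\<^sup>2"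
                using r(1) by (simp add: field_simps power2_eq_square)
              then show ?thesis unfolding F'q by (simp only: r(2))
            qed
            have e2: "2 * F' q + 4 * q * F2 = - (P + P ^ 3 / b\<^sup>2) / r"
            proof -
              have F2: "F2 = - b / 2 * (- 1 / (2 * (h\<^sup>2 * h)) * (- 1)) + c / 2 * (- 1 / (2 * (r\<^sup>2 * r)))"
                unfolding F2_def h_def[symmetric] r_def[symmetric] h(2)[symmetric] r(2)[symmetric] ..
              have "2 * ((c - P) / (2 * r)) + 4 * r\<^sup>2 * F2 = - (P + P ^ 3 / b\<^sup>2) / r"
                unfolding F2 P_def using r(1) h(1) b(1)
                by (simp add: field_simps power2_eq_square power3_eq_cube)
              then show ?thesis unfolding F'q by (simp only: r(2))
            qed
            have e3: "- \<sigma> * b / (2 * h) = - (2 * N + \<delta>) * P / (2 * r)"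
              using r h by (simp add: P_def \<delta>_def)
            ultimately have "2 * N * ((c - P) / (2 * r)) + (- (P + P ^ 3 / b\<^sup>2) / r) / (1 + (P - c)\<^sup>2)
                \<le> - (2 * N + \<delta>) * P / (2 * r)"
              unfolding N_def[symmetric] e1 e2 e3 unfolding F'q by simp
            moreover define X where "X = (P + P ^ 3 / b\<^sup>2) / (1 + (P - c)\<^sup>2)"
            have "(- (P + P ^ 3 / b\<^sup>2) / r) / (1 + (P - c)\<^sup>2) = - X / r"
              unfolding X_def minus_divide_left[symmetric] by (simp add: mult.commute del: minus_add_distrib)
            ultimately have le: "(2 * N * ((c - P) / (2 * r)) + - X / r) * r \<le> (- (2 * N + \<delta>) * P / (2 * r)) * r"
              using r by (intro mult_right_mono) auto
            have e4: "(2 * N * ((c - P) / (2 * r)) + - X / r) * r = N * (c - P) - X"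
              using r(1) by (simp add: distrib_right left_diff_distrib)
            have e5: "(- (2 * N + \<delta>) * P / (2 * r)) * r = - (2 * N + \<delta>) * P / 2"
              using r(1) by (simp only: times_divide_eq_left times_divide_eq_right) simp
            from le have "N * c + \<delta> * P / 2 \<le> X" unfolding e4 e5 by (simp add: algebra_simps)
            with capsule_inequality[OF \<delta> c_def b(2) P0 N] show False by (simp add: X_def)
          qed
        qed
      qed
    qed
    moreover have "M - (b + c) * R \<le> w (x, t)"
      using b c xt by (simp add: w_def a_def)
    ultimately show "ereal (M - (b + c) * R) < v (x, t)" by (meson ereal_less_eq(3) le_less_trans)
  qed
qed

text \<open>
For \<open>w = \<kappa> (|x|\<^sup>2 + 2 (n - 1) t) + \<mu>\<close> the time derivative is \<open>2 (n - 1) \<kappa>\<close>, whereas the mean curvature operator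
is larger by \<open>2 \<kappa> / (1 + 4 \<kappa>\<^sup>2 |x|\<^sup>2)\<close>; so \<open>w\<close> is a strict subsolution.
\<close>
lemma paraboloid_stays_below:
  fixes v :: "(real^'n) \<times> real \<Rightarrow> ereal"
  assumes v: "extended_mcf v" and \<kappa>: "0 < \<kappa>"
    and init: "\<And>x. norm x \<le> R \<Longrightarrow> ereal (\<kappa> * (norm x)\<^sup>2 + \<mu>) < v (x, 0)"
    and lateral: "\<And>x t. norm x = R \<Longrightarrow> 0 \<le> t \<Longrightarrow> t \<le> T \<Longrightarrow> v (x, t) = \<infinity>"
    and x: "norm x \<le> R" and t: "0 \<le> t" "t \<le> T"
  shows "ereal (\<kappa> * ((norm x)\<^sup>2 + 2 * (real CARD('n) - 1) * t) + \<mu>) < v (x, t)"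
proof -
  define N where "N = real CARD('n) - 1"
  define w :: "(real^'n) \<times> real \<Rightarrow> real" where "w z = \<kappa> * ((norm (fst z))\<^sup>2 + 2 * N * snd z) + \<mu>" for z
  define K where "K = cball (0::real^'n) R \<times> {0..T}"
  have "ereal (w (x, t)) < v (x, t)"
  proof (rule first_touching[where K = K and v = v])
    show "compact K" unfolding K_def by (intro compact_Times) auto
    show "K \<subseteq> UNIV \<times> {0..}" by (auto simp: K_def)
    show "continuous_on (UNIV \<times> {0..}) v" using v by (simp add: extended_mcf_def)
    show "continuous_on K w" unfolding w_def by (intro continuous_intros)
    show "(x, t) \<in> K" using x t by (simp add: K_def)
    show "(y, s) \<in> K" if "(y, t) \<in> K" "0 \<le> s" "s \<le> t" for y t s using that by (auto simp: K_def)
    show "ereal (w (y, 0)) < v (y, 0)" if "(y, 0) \<in> K" for y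
      using init[of y] that by (auto simp: K_def w_def)
    show False if K: "(x, t) \<in> K" and t: "0 < t" and eq: "v (x, t) = ereal (w (x, t))"
      and le: "\<And>y s. (y, s) \<in> K \<Longrightarrow> s \<le> t \<Longrightarrow> ereal (w (y, s)) \<le> v (y, s)" for x t
    proof -
      have "norm x \<noteq> R" using lateral[of x t] eq K t by (auto simp: K_def)
      then have xR: "x \<in> ball 0 R" using K by (auto simp: K_def)
      have "\<forall>\<^sub>F y in nhds x. y \<in> ball 0 R" using xR by (intro eventually_nhds_in_open) auto
      then have space: "\<forall>\<^sub>F y in nhds x. ereal (w (y, t)) \<le> v (y, t)"
        by eventually_elim (use K in \<open>auto intro!: le simp: K_def\<close>)
      have "\<forall>\<^sub>F s in at_left t. 0 < s \<and> s < t" using t by (rule eventually_at_left_Ico)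
      then have time: "\<forall>\<^sub>F s in at_left t. ereal (w (x, s)) \<le> v (x, s)"
        by eventually_elim (use K in \<open>auto intro!: le simp: K_def\<close>)
      have "2 * (real CARD('n) - 1) * \<kappa> + (2 * \<kappa> + 4 * (norm x)\<^sup>2 * 0) / (1 + 4 * (norm x)\<^sup>2 * \<kappa>\<^sup>2) \<le> 2 * N * \<kappa>"
      proof (rule radial_touching_from_below[OF v t, where x = x and ?x0.0 = 0
            and F = "\<lambda>q. \<kappa> * (q + 2 * N * t) + \<mu>" and G = "\<lambda>s. w (x, s)" and F' = "\<lambda>_. \<kappa>"])
        show "((\<lambda>s. w (x, s)) has_real_derivative 2 * N * \<kappa>) (at t)"
          unfolding w_def by (auto intro!: derivative_eq_intros)
        show "\<forall>\<^sub>F r in nhds ((norm x)\<^sup>2). ((\<lambda>q. \<kappa> * (q + 2 * N * t) + \<mu>) has_real_derivative \<kappa>) (at r)"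
          by (intro always_eventually allI) (auto intro!: derivative_eq_intros)
      qed (use eq space time in \<open>simp_all add: w_def\<close>)
      moreover have "0 < 2 * \<kappa> / (1 + 4 * (norm x)\<^sup>2 * \<kappa>\<^sup>2)"
        using \<kappa> by (intro divide_pos_pos) (auto intro: add_pos_nonneg)
      ultimately show False by (simp add: N_def)
    qed
  qed
  then show ?thesis by (simp add: w_def N_def)
qed

section \<open>The upper barrier\<close>

lemma DERIV_negative_powr:
  fixes a \<sigma> \<alpha> r :: real
  assumes "\<sigma> * r < a"
  shows "((\<lambda>r. (a - \<sigma> * r) powr - \<alpha>) has_real_derivative \<alpha> * \<sigma> * (a - \<sigma> * r) powr - (\<alpha> + 1)) (at r)"
proof -
  have "((\<lambda>r. a - \<sigma> * r) has_real_derivative - \<sigma>) (at r)" by (auto intro!: derivative_eq_intros)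
  moreover have "((\<lambda>z. z powr - \<alpha>) has_real_derivative - \<alpha> * (a - \<sigma> * r) powr (- \<alpha> - 1)) (at (a - \<sigma> * r))"
    using assms by (intro has_real_derivative_powr) auto
  ultimately have "((\<lambda>r. (a - \<sigma> * r) powr - \<alpha>) has_real_derivative - \<alpha> * (a - \<sigma> * r) powr (- \<alpha> - 1) * - \<sigma>) (at r)"
    by (rule DERIV_chain2[where f = "\<lambda>z. z powr - \<alpha>", rotated])
  also have "- \<alpha> * (a - \<sigma> * r) powr (- \<alpha> - 1) * - \<sigma> = \<alpha> * \<sigma> * (a - \<sigma> * r) powr - (\<alpha> + 1)"
    by (simp add: mult.commute)
  finally show ?thesis .
qed

text \<open>
Stated for the negative of the flow. With \<open>\<psi> s = A (R\<^sup>2 - s) powr - \<alpha>\<close> the barrier is the negative of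
\<open>\<psi> (|x|\<^sup>2 + 2 N t) + \<epsilon> \<psi> (2 N t) - c |x| + K t + k\<close>. It tends to \<open>-\<infinity>\<close> at the edge of its domain while \<open>v\<close> is bounded
below there, so the comparison can be made on the compact set where \<open>|x|\<^sup>2 + 2 N t \<le> R\<^sup>2 - \<eta>\<close>.
\<close>
lemma blowup_barrier:
  fixes v :: "(real^'n) \<times> real \<Rightarrow> ereal"
  assumes v: "extended_mcf v" and n: "2 \<le> CARD('n)" and N_def: "N = real CARD('n) - 1"
    and A: "0 < A" and \<alpha>: "0 < \<alpha>" and \<epsilon>: "0 < \<epsilon>" and R: "0 < R" and c: "0 < c" and K: "0 < K"
    and ineq: "\<And>r y P. \<lbrakk>0 < r; 0 < y; y + r\<^sup>2 \<le> R\<^sup>2; P = 2 * r * (\<alpha> * A) * y powr - (\<alpha> + 1)\<rbrakk> \<Longrightarrow>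
      P * (1 + 2 * (\<alpha> + 1) * r\<^sup>2 / y) / (1 + (P - c)\<^sup>2)
      < c + 2 * \<epsilon> * r * (\<alpha> * A) * (y + r\<^sup>2) powr - (\<alpha> + 1) + K * r"
    and bdd: "\<And>x t. 0 \<le> t \<Longrightarrow> (norm x)\<^sup>2 + 2 * N * t \<le> R\<^sup>2 \<Longrightarrow> ereal (- M) < v (x, t)"
    and init: "\<And>x. norm x < R \<Longrightarrow> ereal (c * norm x - A * (R\<^sup>2 - (norm x)\<^sup>2) powr - \<alpha> - k) < v (x, 0)"
    and t0: "0 \<le> t" and xt: "(norm x)\<^sup>2 + 2 * N * t < R\<^sup>2"
  shows "ereal (c * norm x - A * (R\<^sup>2 - (norm x)\<^sup>2 - 2 * N * t) powr - \<alpha>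
    - \<epsilon> * A * (R\<^sup>2 - 2 * N * t) powr - \<alpha> - K * t - k) < v (x, t)"
proof -
  have N: "1 \<le> N" using n by (simp add: N_def)
  define E where "E = \<bar>M\<bar> + c * R + \<bar>k\<bar> + 1"
  have E: "0 < E" using c R by (simp add: E_def add_nonneg_pos)
  \<comment> \<open>The margin is small enough to include the given point and to push the barrier below the lower bound of the flow on the edge.\<close>
  define \<eta> where "\<eta> = min (R\<^sup>2 - (norm x)\<^sup>2 - 2 * N * t) ((E / A) powr (- 1 / \<alpha>))"
  have \<eta>: "0 < \<eta>" using xt E A by (simp add: \<eta>_def)
  have "((E / A) powr (- 1 / \<alpha>)) powr - \<alpha> \<le> \<eta> powr - \<alpha>"
    using \<eta> \<alpha> by (intro powr_mono2') (auto simp: \<eta>_def)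
  then have "E / A \<le> \<eta> powr - \<alpha>" using \<alpha> E A by (simp add: powr_powr)
  then have EA: "E \<le> A * \<eta> powr - \<alpha>" using A by (simp add: field_simps)
  define Q where "Q = {z :: (real^'n) \<times> real. 0 \<le> snd z \<and> (norm (fst z - 0))\<^sup>2 + 2 * N * snd z \<le> R\<^sup>2 - \<eta>}"
  define w :: "(real^'n) \<times> real \<Rightarrow> real" where
    "w z = c * norm (fst z) - A * (R\<^sup>2 - (norm (fst z))\<^sup>2 - 2 * N * snd z) powr - \<alpha>
      - \<epsilon> * A * (R\<^sup>2 - 2 * N * snd z) powr - \<alpha> - K * snd z - k" for z
  have base: "0 < R\<^sup>2 - (norm (fst z))\<^sup>2 - 2 * N * snd z" "0 < R\<^sup>2 - 2 * N * snd z" if "z \<in> Q" for z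
  proof -
    show 1: "0 < R\<^sup>2 - (norm (fst z))\<^sup>2 - 2 * N * snd z" using that \<eta> by (simp add: Q_def)
    have "0 \<le> (norm (fst z))\<^sup>2" by simp
    with 1 show "0 < R\<^sup>2 - 2 * N * snd z" by linarith
  qed
  have "ereal (w (x, t)) < v (x, t)"
  proof (rule first_touching[where K = Q and v = v])
    show "compact Q" unfolding Q_def using N by (intro compact_parabolic_cap) simp
    show "Q \<subseteq> UNIV \<times> {0..}" by (auto simp: Q_def)
    show "continuous_on (UNIV \<times> {0..}) v" using v by (simp add: extended_mcf_def)
    show "continuous_on Q w"
      unfolding w_def using base by (intro continuous_intros) (auto dest: base)
    show "(x, t) \<in> Q" using t0 xt by (simp add: Q_def \<eta>_def)
    show "(y, s) \<in> Q" if "(y, t) \<in> Q" "0 \<le> s" "s \<le> t" for y t s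
    proof -
      have "2 * N * s \<le> 2 * N * t" using that N by simp
      then show ?thesis using that by (simp add: Q_def)
    qed
    show "ereal (w (y, 0)) < v (y, 0)" if "(y, 0) \<in> Q" for y
    proof -
      have "(norm y)\<^sup>2 < R\<^sup>2" using that \<eta> by (simp add: Q_def)
      then have "norm y < R" using R by (simp add: power_less_imp_less_base)
      moreover have "0 \<le> \<epsilon> * A * R\<^sup>2 powr - \<alpha>" using \<epsilon> A by simp
      then have "w (y, 0) \<le> c * norm y - A * (R\<^sup>2 - (norm y)\<^sup>2) powr - \<alpha> - k" by (simp add: w_def)
      ultimately show ?thesis using init by (meson ereal_less_eq(3) le_less_trans)
    qed
    show False if Q: "(x, t) \<in> Q" and t: "0 < t" and eq: "v (x, t) = ereal (w (x, t))"
      and le: "\<And>y s. (y, s) \<in> Q \<Longrightarrow> s \<le> t \<Longrightarrow> ereal (w (y, s)) \<le> v (y, s)" for x t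
    proof -
      define q where "q = (norm x)\<^sup>2"
      define Y where "Y = R\<^sup>2 - 2 * N * t"
      define \<beta> where "\<beta> = \<alpha> + 1"
      define B where "B = \<alpha> * A"
      have Y0: "0 < Y" using base(2)[OF Q] by (simp add: Y_def)
      have qY: "q \<le> Y - \<eta>" using Q by (simp add: Q_def q_def Y_def)
      have "\<forall>\<^sub>F s in at_left t. 0 < s \<and> s < t" using t by (rule eventually_at_left_Ico)
      then have time: "\<forall>\<^sub>F s in at_left t. ereal (w (x, s)) \<le> v (x, s)"
      proof eventually_elim
        case (elim s)
        then have "2 * N * s \<le> 2 * N * t" using N by simp
        then show ?case using elim Q by (intro le) (auto simp: Q_def)
      qed
      have "q \<noteq> Y - \<eta>"
      proof
        assume qe: "q = Y - \<eta>"
        have "q \<le> R\<^sup>2" using qY \<eta> t N by (simp add: Y_def) (smt (verit) mult_nonneg_nonneg)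
        then have "norm x \<le> R" using R by (simp add: q_def power2_le_iff_abs_le)
        then have "c * norm x \<le> c * R" using c by simp
        moreover have "w (x, t) = c * norm x - A * \<eta> powr - \<alpha> - \<epsilon> * A * Y powr - \<alpha> - K * t - k"
        proof -
          have "R\<^sup>2 - (norm x)\<^sup>2 - 2 * N * t = \<eta>" using qe by (simp add: q_def Y_def)
          then show ?thesis by (simp add: w_def Y_def)
        qed
        moreover have "0 \<le> \<epsilon> * A * Y powr - \<alpha>" "0 \<le> K * t" using \<epsilon> A K t by auto
        ultimately have "w (x, t) \<le> - M" using EA unfolding E_def by linarith
        moreover have "ereal (- M) < v (x, t)"
          using Q t \<eta> by (intro bdd) (auto simp: Q_def)
        ultimately show False unfolding eq by simp
      qed
      with qY have qY: "q < Y - \<eta>" by simp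
      have "\<forall>\<^sub>F y in nhds x. (norm (y - 0))\<^sup>2 \<le> Y - \<eta>"
        using qY by (intro eventually_near_in_cap) (simp add: q_def)
      then have space: "\<forall>\<^sub>F y in nhds x. ereal (w (y, t)) \<le> v (y, t)"
        by eventually_elim (use t in \<open>auto intro!: le simp: Q_def Y_def\<close>)
      \<comment> \<open>The smooth part of the barrier as a function of the squared radius; the remaining term has its corner at the origin.\<close>
      define F0 where "F0 r = - A * (Y - 1 * r) powr - \<alpha> - \<epsilon> * A * Y powr - \<alpha> - K * t - k" for r
      have w: "w (y, t) = F0 ((norm y)\<^sup>2) + c * norm y" for y
        by (simp add: w_def F0_def Y_def algebra_simps)
      have F0: "(F0 has_real_derivative - B * (Y - 1 * r) powr - \<beta>) (at r)" if "r < Y" for r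
        unfolding F0_def \<beta>_def B_def
        using that by (auto intro!: derivative_eq_intros DERIV_negative_powr)
      show False
      proof (cases "q = 0")
        case True
        then have x: "x = 0" by (simp add: q_def)
        show False
        proof (rule convex_kink_cannot_touch[OF v t c, where F = F0 and x = x])
          show "v (x, t) = ereal (F0 0)" unfolding eq w by (simp add: x)
          show "\<forall>\<^sub>F y in nhds x. ereal (F0 ((norm (y - x))\<^sup>2) + c * norm (y - x)) \<le> v (y, t)"
            using space unfolding w by (simp add: x)
          show "(F0 has_real_derivative - B * (Y - 1 * 0) powr - \<beta>) (at 0)" using Y0 by (rule F0)
        qed
      next
        case False
        then have q: "0 < q" by (simp add: q_def)
        define y where "y = Y - q"
        have y: "0 < y" using qY \<eta> by (simp add: y_def)
        define F' where "F' r = - B * (Y - 1 * r) powr - \<beta> + c / 2 * inverse (sqrt r)" for r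
        define F2 where "F2 = - B * (\<beta> * 1 * (Y - 1 * q) powr - (\<beta> + 1)) + c / 2 * (- 1 / (2 * (q * sqrt q)))"
        define D where "D = - 2 * N * B * y powr - \<beta> - 2 * N * \<epsilon> * B * Y powr - \<beta> - K"
        define r where "r = sqrt q"
        have r: "0 < r" "q = r\<^sup>2" using q by (auto simp: r_def)
        have touch: "2 * (real CARD('n) - 1) * F' q + (2 * F' q + 4 * q * F2) / (1 + 4 * q * (F' q)\<^sup>2) \<le> D"
        proof (rule radial_touching_from_below[OF v t, where x = x and ?x0.0 = 0
              and F = "\<lambda>q. F0 q + c * sqrt q" and G = "\<lambda>s. w (x, s)"])
          show "v (x, t) = ereal (F0 ((norm (x - 0))\<^sup>2) + c * sqrt ((norm (x - 0))\<^sup>2))"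
            by (simp add: eq w)
          show "w (x, t) = F0 ((norm (x - 0))\<^sup>2) + c * sqrt ((norm (x - 0))\<^sup>2)"
            by (simp add: w)
          show "\<forall>\<^sub>F y in nhds x. ereal (F0 ((norm (y - 0))\<^sup>2) + c * sqrt ((norm (y - 0))\<^sup>2)) \<le> v (y, t)"
            using space by (simp add: w)
          have "((\<lambda>s. c * norm x - A * (R\<^sup>2 - (norm x)\<^sup>2 - 2 * N * s) powr - \<alpha>
              - \<epsilon> * A * (R\<^sup>2 - 2 * N * s) powr - \<alpha> - K * s - k) has_real_derivative
              0 - A * (\<alpha> * (2 * N) * (R\<^sup>2 - (norm x)\<^sup>2 - 2 * N * t) powr - (\<alpha> + 1))
              - \<epsilon> * A * (\<alpha> * (2 * N) * (R\<^sup>2 - 2 * N * t) powr - (\<alpha> + 1)) - K * 1 - 0) (at t)"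
            using base[OF Q] by (intro DERIV_diff DERIV_const DERIV_cmult DERIV_negative_powr DERIV_ident) auto
          moreover have "R\<^sup>2 - (norm x)\<^sup>2 - 2 * N * t = y" by (simp add: y_def Y_def q_def)
          ultimately show "((\<lambda>s. w (x, s)) has_real_derivative D) (at t)"
            by (simp add: w_def D_def B_def \<beta>_def Y_def mult.assoc mult.left_commute)
          have "\<forall>\<^sub>F r in nhds q. r \<in> {0<..<Y}" using q qY \<eta> by (intro eventually_nhds_in_open) auto
          then show "\<forall>\<^sub>F r in nhds q. ((\<lambda>q. F0 q + c * sqrt q) has_real_derivative F' r) (at r)"
          proof eventually_elim
            case (elim r)
            then have "((\<lambda>q. F0 q + c * sqrt q) has_real_derivative
                - B * (Y - 1 * r) powr - \<beta> + c * (inverse (sqrt r) / 2)) (at r)"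
              by (intro DERIV_add F0 DERIV_cmult DERIV_real_sqrt) auto
            then show ?case by (simp add: F'_def)
          qed
          show "(F' has_real_derivative F2) (at q)"
            unfolding F'_def F2_def using q y
            by (intro DERIV_add DERIV_cmult DERIV_inverse_sqrt DERIV_negative_powr) (auto simp: y_def)
        qed (use time in \<open>auto simp: q_def\<close>)
        define P where "P = 2 * r * B * y powr - \<beta>"
        define X where "X = P * (1 + 2 * \<beta> * r\<^sup>2 / y) / (1 + (P - c)\<^sup>2)"
        have F'q: "F' q = (c - P) / (2 * r)"
          using r(1) by (simp add: F'_def P_def r_def[symmetric] y_def[symmetric] field_simps)
        have e1: "4 * q * (F' q)\<^sup>2 = (P - c)\<^sup>2"
        proof -
          have "4 * r\<^sup>2 * ((c - P) / (2 * r))\<^sup>2 = (P - c)\<^sup>2"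
            using r(1) by (simp add: field_simps power2_eq_square)
          then show ?thesis unfolding F'q by (simp only: r(2))
        qed
        \<comment> \<open>The corner term drops out here: it is linear along rays.\<close>
        have e2: "2 * F' q + 4 * q * F2 = - (P * (1 + 2 * \<beta> * r\<^sup>2 / y)) / r"
        proof -
          have "y powr - (\<beta> + 1) = y powr - \<beta> / y"
            using y powr_diff[of y "- \<beta>" 1] by simp
          then have F2: "F2 = - B * (\<beta> * (y powr - \<beta> / y)) + c / 2 * (- 1 / (2 * (r\<^sup>2 * r)))"
            unfolding F2_def r_def[symmetric] r(2)[symmetric] by (simp add: y_def)
          have "2 * ((c - P) / (2 * r)) + 4 * r\<^sup>2 * F2 = - (P * (1 + 2 * \<beta> * r\<^sup>2 / y)) / r"
            unfolding F2 P_def using r(1) y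
            by (simp add: field_simps power2_eq_square)
          then show ?thesis unfolding F'q by (simp only: r(2))
        qed
        have e3: "(- (P * (1 + 2 * \<beta> * r\<^sup>2 / y)) / r) / (1 + (P - c)\<^sup>2) = - X / r"
          unfolding X_def minus_divide_left[symmetric] by (simp only: divide_divide_eq_left mult.commute)
        from touch have "2 * N * ((c - P) / (2 * r)) + - X / r \<le> D"
          unfolding N_def[symmetric] e1 e2 e3 unfolding F'q .
        then have le: "(2 * N * ((c - P) / (2 * r)) + - X / r) * r \<le> D * r"
          using r(1) by (intro mult_right_mono) auto
        have e4: "(2 * N * ((c - P) / (2 * r)) + - X / r) * r = N * (c - P) - X"
          using r(1) by (simp add: distrib_right left_diff_distrib)
        have e5: "D * r = - N * P - N * (2 * \<epsilon> * r * B * Y powr - \<beta>) - K * r"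
          by (simp add: D_def P_def algebra_simps)
        from le have "N * (c + 2 * \<epsilon> * r * B * Y powr - \<beta>) + K * r \<le> X"
          unfolding e4 e5 by (simp add: algebra_simps)
        moreover have "c + 2 * \<epsilon> * r * B * Y powr - \<beta> \<le> N * (c + 2 * \<epsilon> * r * B * Y powr - \<beta>)"
        proof -
          have "0 \<le> c + 2 * \<epsilon> * r * B * Y powr - \<beta>" using c \<epsilon> r A \<alpha> by (simp add: B_def)
          from mult_right_mono[OF N this] show ?thesis by simp
        qed
        moreover have "X < c + 2 * \<epsilon> * r * B * (y + r\<^sup>2) powr - \<beta> + K * r"
          unfolding X_def B_def \<beta>_def
        proof (rule ineq)
          show "y + r\<^sup>2 \<le> R\<^sup>2" using t N r(2) by (simp add: y_def Y_def)
        qed (use r y in \<open>simp_all add: P_def B_def \<beta>_def\<close>)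
        moreover have "y + r\<^sup>2 = Y" using r(2) by (simp add: y_def)
        ultimately show False by simp
      qed
    qed
  qed
  then show ?thesis by (simp add: w_def)
qed

section \<open>Asymptotic profiles and initial data\<close>

text \<open>
Applied with \<open>r = |x|\<close> to the initial data and with \<open>r = \<surd>(2 (n - 1) t)\<close> to the claim about the origin. The profile on the
right is smooth in the variable \<open>r\<^sup>2\<close>, which the barriers need at \<open>r = 0\<close>.
\<close>
lemma asymp_equiv_blowup_profiles:
  fixes \<rho> \<alpha> C :: real
  assumes "0 < \<rho>"
  shows "(\<lambda>r. C * (\<rho> - r) powr - \<alpha>) \<sim>[at_left \<rho>] (\<lambda>r. C * (2 * \<rho>) powr \<alpha> * (\<rho>\<^sup>2 - r\<^sup>2) powr - \<alpha>)"
proof -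
  have "((\<lambda>r. (\<rho>\<^sup>2 - r\<^sup>2) / (2 * \<rho>) / (\<rho> - r)) \<longlongrightarrow> 1) (at_left \<rho>)"
  proof (rule Lim_transform_eventually)
    show "((\<lambda>r. (\<rho> + r) / (2 * \<rho>)) \<longlongrightarrow> 1) (at_left \<rho>)"
      using assms by (auto intro!: tendsto_eq_intros)
    have "\<forall>\<^sub>F r in at_left \<rho>. r < \<rho>" by (simp add: eventually_at_filter)
    then show "\<forall>\<^sub>F r in at_left \<rho>. (\<rho> + r) / (2 * \<rho>) = (\<rho>\<^sup>2 - r\<^sup>2) / (2 * \<rho>) / (\<rho> - r)"
      by eventually_elim (use assms in \<open>simp add: field_simps power2_eq_square\<close>)
  qed
  then have "(\<lambda>r. (\<rho>\<^sup>2 - r\<^sup>2) / (2 * \<rho>)) \<sim>[at_left \<rho>] (\<lambda>r. \<rho> - r)" by (rule asymp_equivI')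
  moreover have ev: "\<forall>\<^sub>F r in at_left \<rho>. 0 < r \<and> r < \<rho>" using assms by (rule eventually_at_left_Ico)
  then have pos: "\<forall>\<^sub>F r in at_left \<rho>. 0 \<le> \<rho> - r" "\<forall>\<^sub>F r in at_left \<rho>. 0 \<le> (\<rho>\<^sup>2 - r\<^sup>2) / (2 * \<rho>)"
    by (eventually_elim, use assms in \<open>auto intro: power_mono\<close>)+
  ultimately have "(\<lambda>r. ((\<rho>\<^sup>2 - r\<^sup>2) / (2 * \<rho>)) powr - \<alpha>) \<sim>[at_left \<rho>] (\<lambda>r. (\<rho> - r) powr - \<alpha>)"
    by (intro asymp_equiv_powr_real)
  then have "(\<lambda>r. C * (\<rho> - r) powr - \<alpha>) \<sim>[at_left \<rho>] (\<lambda>r. C * ((\<rho>\<^sup>2 - r\<^sup>2) / (2 * \<rho>)) powr - \<alpha>)"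
    by (intro asymp_equiv_mult asymp_equiv_refl) (rule asymp_equiv_symI)
  moreover have "\<forall>\<^sub>F r in at_left \<rho>. C * ((\<rho>\<^sup>2 - r\<^sup>2) / (2 * \<rho>)) powr - \<alpha> = C * (2 * \<rho>) powr \<alpha> * (\<rho>\<^sup>2 - r\<^sup>2) powr - \<alpha>"
    using ev
  proof eventually_elim
    case (elim r)
    then have "0 \<le> \<rho>\<^sup>2 - r\<^sup>2" by (simp add: power_mono)
    then have "((\<rho>\<^sup>2 - r\<^sup>2) / (2 * \<rho>)) powr - \<alpha> = (\<rho>\<^sup>2 - r\<^sup>2) powr - \<alpha> / (2 * \<rho>) powr - \<alpha>"
      using assms by (simp only: powr_divide)
    then show ?case by (simp add: powr_minus field_simps)
  qed
  ultimately show ?thesis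
    using asymp_equiv_cong[of "\<lambda>r. C * (\<rho> - r) powr - \<alpha>" "\<lambda>r. C * (\<rho> - r) powr - \<alpha>"] by fastforce
qed

text \<open>
Asymptotic equivalence at the boundary turned into a two-sided bound on the whole ball: inside a smaller
closed ball everything is bounded, which is paid for by the constant \<open>k\<close>.
\<close>
lemma blowup_data_bounds:
  fixes u0 :: "'a::euclidean_space \<Rightarrow> real"
  assumes \<rho>: "0 < \<rho>" and A: "0 < A" and cont: "continuous_on (ball 0 \<rho>) u0"
    and u0: "u0 \<sim>[filtercomap norm (at_left \<rho>)] (\<lambda>x. A * (\<rho>\<^sup>2 - (norm x)\<^sup>2) powr - \<alpha>)"
    and \<epsilon>: "0 < \<epsilon>"
  obtains k where "\<And>x. norm x < \<rho> \<Longrightarrow> \<bar>u0 x - A * (\<rho>\<^sup>2 - (norm x)\<^sup>2) powr - \<alpha>\<bar> \<le> \<epsilon> * A * (\<rho>\<^sup>2 - (norm x)\<^sup>2) powr - \<alpha> + k"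
proof -
  define g where "g x = A * (\<rho>\<^sup>2 - (norm x)\<^sup>2) powr - \<alpha>" for x :: 'a
  have Y: "0 < \<rho>\<^sup>2 - (norm x)\<^sup>2" if "norm x < \<rho>" for x :: 'a
    using that by (simp add: power_strict_mono)
  have g: "0 < g x" if "norm x < \<rho>" for x using A Y[OF that] by (simp add: g_def)
  have "\<forall>\<^sub>F x in filtercomap norm (at_left \<rho>). dist (if u0 x = 0 \<and> g x = 0 then 1 else u0 x / g x) 1 < \<epsilon>"
    using asymp_equivD[OF u0[folded g_def]] \<epsilon> by (rule tendstoD)
  then obtain b where b: "b < \<rho>"
    "\<And>x. b < norm x \<Longrightarrow> norm x < \<rho> \<Longrightarrow> dist (if u0 x = 0 \<and> g x = 0 then 1 else u0 x / g x) 1 < \<epsilon>"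
    unfolding eventually_filtercomap eventually_at_left[OF \<rho>] by auto
  have sub: "cball 0 b \<subseteq> (ball 0 \<rho> :: 'a set)" using b(1) by auto
  have "continuous_on (cball 0 b) (\<lambda>x. u0 x - g x)"
    unfolding g_def
  proof (intro continuous_intros continuous_on_subset[OF cont sub] ballI)
    fix x :: 'a assume "x \<in> cball 0 b"
    then have "norm x < \<rho>" using b(1) by simp
    then show "\<rho>\<^sup>2 - (norm x)\<^sup>2 \<noteq> 0" using Y[of x] by simp
  qed
  then have "bounded ((\<lambda>x. u0 x - g x) ` cball 0 b)"
    by (intro compact_imp_bounded compact_continuous_image) auto
  then obtain k where "\<forall>y\<in>(\<lambda>x. u0 x - g x) ` cball 0 b. norm y \<le> k"
    unfolding bounded_iff by blast
  then have k: "\<bar>u0 x - g x\<bar> \<le> k" if "x \<in> cball 0 b" for x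
    using that by auto
  show ?thesis
  proof (rule that[of "\<bar>k\<bar>"])
    fix x :: 'a assume x: "norm x < \<rho>"
    have "\<bar>u0 x - g x\<bar> \<le> \<epsilon> * g x + \<bar>k\<bar>"
    proof (cases "norm x \<le> b")
      case True
      with k[of x] have "\<bar>u0 x - g x\<bar> \<le> k" by simp
      moreover have "0 \<le> \<epsilon> * g x" using \<epsilon> g[OF x] by simp
      ultimately show ?thesis by linarith
    next
      case False
      with b(2)[of x] x g[OF x] have "\<bar>u0 x / g x - 1\<bar> < \<epsilon>" by (simp add: dist_real_def)
      moreover have "u0 x / g x - 1 = (u0 x - g x) / g x" using g[OF x] by (simp add: field_simps)
      ultimately have "\<bar>u0 x - g x\<bar> < \<epsilon> * g x" using g[OF x] by (simp add: pos_divide_less_eq)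
      then show ?thesis by simp
    qed
    then show "\<bar>u0 x - A * (\<rho>\<^sup>2 - (norm x)\<^sup>2) powr - \<alpha>\<bar> \<le> \<epsilon> * A * (\<rho>\<^sup>2 - (norm x)\<^sup>2) powr - \<alpha> + \<bar>k\<bar>"
      by (simp add: g_def)
  qed
qed

text \<open>
Additive constants, which the comparison arguments produce in abundance, are invisible at blow-up.
\<close>
lemma asymp_equiv_of_relative_bounds:
  fixes f g :: "'a \<Rightarrow> real"
  assumes g: "filterlim g at_top F"
    and bounds: "\<And>\<epsilon>. 0 < \<epsilon> \<Longrightarrow> \<epsilon> < 1 \<Longrightarrow> \<exists>k. \<forall>\<^sub>F x in F. \<bar>f x - g x\<bar> \<le> \<epsilon> * g x + k"
  shows "f \<sim>[F] g"
proof (rule asymp_equivI')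
  show "((\<lambda>x. f x / g x) \<longlongrightarrow> 1) F"
  proof (rule tendstoI)
    fix e :: real assume e: "0 < e"
    define \<epsilon> where "\<epsilon> = min (e / 2) (1 / 2)"
    have \<epsilon>: "0 < \<epsilon>" "\<epsilon> < 1" "\<epsilon> \<le> e / 2" using e by (auto simp: \<epsilon>_def)
    obtain k where k: "\<forall>\<^sub>F x in F. \<bar>f x - g x\<bar> \<le> \<epsilon> * g x + k" using bounds[OF \<epsilon>(1,2)] by blast
    have "\<forall>\<^sub>F x in F. max 1 (2 * (\<bar>k\<bar> + 1) / e) \<le> g x" using g unfolding filterlim_at_top by blast
    with k show "\<forall>\<^sub>F x in F. dist (f x / g x) 1 < e"
    proof eventually_elim
      case (elim x)
      then have g0: "0 < g x" and "2 * (\<bar>k\<bar> + 1) / e \<le> g x" by auto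
      then have "k < e / 2 * g x" using e by (simp add: field_simps)
      moreover have "\<epsilon> * g x \<le> e / 2 * g x" using \<epsilon>(3) g0 by (intro mult_right_mono) auto
      ultimately have "\<bar>f x - g x\<bar> < e * g x" using elim(1) by simp
      moreover have "f x / g x - 1 = (f x - g x) / g x" using g0 by (simp add: field_simps)
      ultimately show ?case using g0 by (simp add: dist_real_def pos_divide_less_eq)
    qed
  qed
qed

text \<open>
The values on the complement of the ball are \<open>\<plusminus>\<infinity>\<close>. On the boundary sphere the lower bound passes to the limit from
inside and forces \<open>+\<infinity>\<close>; in dimension at least two the complement is connected, so a continuous function cannot change
to \<open>-\<infinity>\<close> anywhere else.
\<close>
lemma infinite_outside_ball:
  fixes v :: "real^'n \<Rightarrow> ereal"
  assumes n: "2 \<le> CARD('n)" and \<rho>: "0 < \<rho>" and cont: "continuous_on UNIV v"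
    and inf: "\<And>x. x \<notin> ball 0 \<rho> \<Longrightarrow> \<bar>v x\<bar> = \<infinity>"
    and bound: "\<And>x. x \<in> ball 0 \<rho> \<Longrightarrow> ereal m \<le> v x"
    and x: "\<rho> \<le> norm x"
  shows "v x = \<infinity>"
proof (rule ccontr)
  assume "v x \<noteq> \<infinity>"
  then have vx: "v x = - \<infinity>" using inf[of x] x by auto
  define y :: "real^'n" where "y = \<rho> *\<^sub>R axis undefined 1"
  have ny: "norm y = \<rho>" using \<rho> by (simp add: y_def)
  have "closed {y. ereal m \<le> v y}" by (intro closed_Collect_le continuous_on_const cont)
  moreover have "ball 0 \<rho> \<subseteq> {y. ereal m \<le> v y}" using bound by blast
  ultimately have "closure (ball 0 \<rho>) \<subseteq> {y. ereal m \<le> v y}" by (intro closure_minimal)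
  then have "ereal m \<le> v y" using ny \<rho> by auto
  then have vy: "v y = \<infinity>" using inf[of y] ny by auto
  have "connected (- ball (0::real^'n) \<rho>)"
    using n by (intro connected_complement_bounded_convex) auto
  then have "connected (v ` (- ball 0 \<rho>))"
    using cont by (intro connected_continuous_image) (auto intro: continuous_on_subset)
  moreover have "v x \<in> v ` (- ball 0 \<rho>)" "v y \<in> v ` (- ball 0 \<rho>)" using x ny by auto
  ultimately have "0 \<in> v ` (- ball 0 \<rho>)"
    by (rule connectedD_interval) (simp_all add: vx vy)
  then obtain z where "z \<notin> ball 0 \<rho>" "v z = 0" by auto
  with inf[of z] show False by simp
qed

lemma tangent_below_blowup_profile:
  fixes S s s1 a \<alpha> :: real
  assumes "0 < a" "0 < \<alpha>" "s < S" "s1 < S"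
  shows "a * (S - s1) powr - \<alpha> + a * \<alpha> * (S - s1) powr - (\<alpha> + 1) * (s - s1) \<le> a * (S - s) powr - \<alpha>"
proof -
  have d1: "((\<lambda>r. a * (S - 1 * r) powr - \<alpha>) has_real_derivative a * (\<alpha> * 1 * (S - 1 * r) powr - (\<alpha> + 1))) (at r)"
    if "r < S" for r
    using that by (intro DERIV_cmult DERIV_negative_powr) simp
  have d2: "((\<lambda>r. a * (\<alpha> * 1 * (S - 1 * r) powr - (\<alpha> + 1))) has_real_derivative
      a * (\<alpha> * 1 * ((\<alpha> + 1) * 1 * (S - 1 * r) powr - (\<alpha> + 1 + 1)))) (at r)"
    if "r < S" for r
    using that by (intro DERIV_cmult DERIV_negative_powr) simp
  have "convex_on {..<S} (\<lambda>r. a * (S - 1 * r) powr - \<alpha>)"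
    by (rule f''_ge0_imp_convex[OF _ d1 d2]) (use assms in \<open>auto simp: convex_real_interval\<close>)
  from convex_on_imp_above_tangent[OF this _ _ _ has_field_derivative_at_within[OF d1[of s1]], of s]
  have "a * (\<alpha> * 1 * (S - 1 * s1) powr - (\<alpha> + 1)) * (s - s1) \<le> a * (S - 1 * s) powr - \<alpha> - a * (S - 1 * s1) powr - \<alpha>"
    using assms by (simp add: interior_open is_interval_connected)
  then have "a * (\<alpha> * (S - s1) powr - (\<alpha> + 1)) * (s - s1) \<le> a * (S - s) powr - \<alpha> - a * (S - s1) powr - \<alpha>"
    by (simp only: mult_1 mult_1_right)
  then show ?thesis by argo
qed

section \<open>Bounds for the height at the centre\<close>

text \<open>
The profile is convex in \<open>s = |x|\<^sup>2 + 2 N t\<close>, so it is the supremum of its tangent lines, and each tangent line is a paraboloid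
of the kind that stays below the flow. The tangent at \<open>s = 2 N t\<close> gives the value at the origin. The paraboloids
need a lateral boundary on which \<open>v = \<infinity>\<close>: far outside the ball infinite values persist up to
any given time.
\<close>
lemma flow_lower_bound:
  fixes v :: "(real^'n) \<times> real \<Rightarrow> ereal"
  assumes v: "extended_mcf v" and n: "2 \<le> CARD('n)" and N_def: "N = real CARD('n) - 1"
    and \<rho>: "0 < \<rho>" and a: "0 < a" and \<alpha>: "0 < \<alpha>"
    and inside: "\<And>x. norm x < \<rho> \<Longrightarrow> ereal (a * (\<rho>\<^sup>2 - (norm x)\<^sup>2) powr - \<alpha> - k) \<le> v (x, 0)"
    and outside: "\<And>x. \<rho> \<le> norm x \<Longrightarrow> v (x, 0) = \<infinity>"
    and t: "0 \<le> t" and \<tau>: "2 * N * t < \<rho>\<^sup>2"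
  shows "ereal (a * (\<rho>\<^sup>2 - 2 * N * t) powr - \<alpha> - k - 1) < v (0, t)"
proof -
  have N: "1 \<le> N" using n by (simp add: N_def)
  define \<sigma> where "\<sigma> = 2 * N + 1"
  \<comment> \<open>A ball of radius \<open>r\<close> outside the initial one does not shrink to its centre before time \<open>t\<close>: \<open>\<sigma> t \<le> r\<^sup>2\<close>.\<close>
  define r where "r = 1 + \<sigma> * t"
  have r: "0 < r" using t N by (simp add: r_def \<sigma>_def add_pos_nonneg)
  define \<kappa> where "\<kappa> = a * \<alpha> * (\<rho>\<^sup>2 - 2 * N * t) powr - (\<alpha> + 1)"
  define \<mu> where "\<mu> = a * (\<rho>\<^sup>2 - 2 * N * t) powr - \<alpha> - \<kappa> * (2 * N * t) - k - 1"
  have "0 < \<kappa>" using a \<alpha> \<tau> by (simp add: \<kappa>_def)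
  have "ereal (\<kappa> * ((norm (0::real^'n))\<^sup>2 + 2 * (real CARD('n) - 1) * t) + \<mu>) < v (0, t)"
  proof (rule paraboloid_stays_below[OF v \<open>0 < \<kappa>\<close>, where R = "\<rho> + r" and T = t])
    show "ereal (\<kappa> * (norm x)\<^sup>2 + \<mu>) < v (x, 0)" for x
    proof (cases "norm x < \<rho>")
      case True
      then have "(norm x)\<^sup>2 < \<rho>\<^sup>2" by (simp add: power_strict_mono)
      from tangent_below_blowup_profile[OF a \<alpha> this \<tau>, folded \<kappa>_def]
      have "\<kappa> * (norm x)\<^sup>2 + \<mu> < a * (\<rho>\<^sup>2 - (norm x)\<^sup>2) powr - \<alpha> - k"
        unfolding \<mu>_def right_diff_distrib by linarith
      then have "ereal (\<kappa> * (norm x)\<^sup>2 + \<mu>) < ereal (a * (\<rho>\<^sup>2 - (norm x)\<^sup>2) powr - \<alpha> - k)" by simp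
      also have "\<dots> \<le> v (x, 0)" using True by (rule inside)
      finally show ?thesis .
    qed (simp add: outside)
    show "v (x, s) = \<infinity>" if x: "norm x = \<rho> + r" and s: "0 \<le> s" "s \<le> t" for x s
    proof -
      have "2 * (real CARD('n) - 1) < \<sigma>" by (simp add: \<sigma>_def N_def)
      from lower_bound_persists[OF v n r this, of x]
      obtain D where D: "\<And>M y s. (\<And>y. y \<in> cball x r \<Longrightarrow> ereal M < v (y, 0)) \<Longrightarrow> 0 \<le> s \<Longrightarrow>
          (norm (y - x))\<^sup>2 + \<sigma> * s \<le> r\<^sup>2 \<Longrightarrow> ereal (M - D) < v (y, s)" by metis
      show ?thesis
      proof (rule ereal_top)
        fix M
        have "ereal ((M + D) - D) < v (x, s)"
        proof (rule D)
          fix y assume "y \<in> cball x r"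
          then have "norm (x - y) \<le> r" by (simp add: dist_norm)
          then have "\<rho> \<le> norm y" using norm_triangle_ineq2[of x y] x by linarith
          then show "ereal (M + D) < v (y, 0)" by (simp add: outside)
        next
          have "\<sigma> * s \<le> \<sigma> * t" using s N by (simp add: \<sigma>_def mult_left_mono)
          also have "\<dots> \<le> r" by (simp add: r_def)
          also have "r \<le> r * r" using mult_left_mono[of 1 r r] r t N by (simp add: r_def \<sigma>_def)
          finally show "(norm (x - x))\<^sup>2 + \<sigma> * s \<le> r\<^sup>2" by (simp add: power2_eq_square)
        qed (use s in simp)
        then show "ereal M \<le> v (x, s)" by simp
      qed
    qed
  qed (use t \<rho> r in auto)
  moreover have "\<kappa> * ((norm (0::real^'n))\<^sup>2 + 2 * N * t) + \<mu> = a * (\<rho>\<^sup>2 - 2 * N * t) powr - \<alpha> - k - 1"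
    by (simp add: \<mu>_def)
  ultimately show ?thesis unfolding N_def[symmetric] by (simp only:)
qed

text \<open>
A point strictly inside the shrinking ball of squared radius \<open>\<rho>\<^sup>2 - 2 N t\<close> is still inside when the initial radius is slightly
smaller and the rate slightly larger, and then \<open>lower_bound_persists\<close> applies.
\<close>
lemma flow_avoids_minus_infinity:
  fixes v :: "(real^'n) \<times> real \<Rightarrow> ereal"
  assumes v: "extended_mcf v" and n: "2 \<le> CARD('n)" and N_def: "N = real CARD('n) - 1"
    and inside: "\<And>R. 0 < R \<Longrightarrow> R < \<rho> \<Longrightarrow> \<exists>M. \<forall>x. norm x \<le> R \<longrightarrow> ereal M < v (x, 0)"
    and \<rho>: "0 < \<rho>" and t: "0 \<le> t" and s: "(norm x)\<^sup>2 + 2 * N * t < \<rho>\<^sup>2"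
  shows "- \<infinity> < v (x, t)"
proof -
  have N: "1 \<le> N" using n by (simp add: N_def)
  define S where "S = (norm x)\<^sup>2 + 2 * N * t"
  have S0: "0 \<le> S" using N t by (simp add: S_def)
  have S: "S < \<rho>\<^sup>2" using s by (simp add: S_def)
  \<comment> \<open>Half of the gap between \<open>S\<close> and \<open>\<rho>\<^sup>2\<close> goes into the radius, the other half into the rate.\<close>
  define R where "R = sqrt ((S + \<rho>\<^sup>2) / 2)"
  have R0: "0 < R" using S0 \<rho> by (simp add: R_def add_nonneg_pos)
  have R2: "R\<^sup>2 = (S + \<rho>\<^sup>2) / 2" using S0 by (simp add: R_def)
  have R\<rho>: "R < \<rho>"
    by (rule power_less_imp_less_base[of _ 2]) (use R2 S \<rho> in auto)
  define \<delta> where "\<delta> = (\<rho>\<^sup>2 - S) / (2 * (t + 1))"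
  have \<delta>: "0 < \<delta>" using S t by (simp add: \<delta>_def)
  have "\<delta> * t \<le> \<delta> * (t + 1)" using \<delta> by simp
  also have "\<dots> = (\<rho>\<^sup>2 - S) / 2" using t by (simp add: \<delta>_def field_simps)
  finally have "\<delta> * t \<le> (\<rho>\<^sup>2 - S) / 2" .
  then have le: "(norm (x - 0))\<^sup>2 + (2 * N + \<delta>) * t \<le> R\<^sup>2"
    by (simp add: R2 S_def algebra_simps)
  obtain M where M: "\<And>x. norm x \<le> R \<Longrightarrow> ereal M < v (x, 0)" using inside[OF R0 R\<rho>] by blast
  have "2 * (real CARD('n) - 1) < 2 * N + \<delta>" using \<delta> by (simp add: N_def)
  from lower_bound_persists[OF v n R0 this, of 0]
  obtain D where D: "\<And>M x t. (\<And>y. y \<in> cball 0 R \<Longrightarrow> ereal M < v (y, 0)) \<Longrightarrow> 0 \<le> t \<Longrightarrow>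
      (norm (x - 0))\<^sup>2 + (2 * N + \<delta>) * t \<le> R\<^sup>2 \<Longrightarrow> ereal (M - D) < v (x, t)" by metis
  have "ereal (M - D) < v (x, t)" using M t le by (intro D) auto
  then show ?thesis by (rule le_less_trans[rotated]) simp
qed

text \<open>
The barrier with blow-up radius \<open>\<rho>\<close> cannot be compared directly, since the flow may be infinite at its edge too. For a radius
\<open>R < \<rho>\<close> the flow is bounded where the barrier blows up; the constants \<open>c\<close>, \<open>K\<close>, \<open>k'\<close> are uniform in \<open>R\<close>, and
\<open>R\<close> then tends to \<open>\<rho>\<close>.
\<close>
lemma flow_upper_bound:
  fixes v :: "(real^'n) \<times> real \<Rightarrow> ereal"
  assumes v: "extended_mcf v" and n: "2 \<le> CARD('n)" and N_def: "N = real CARD('n) - 1"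
    and \<rho>: "0 < \<rho>" and A: "0 < A" and \<alpha>: "0 < \<alpha>" and \<epsilon>: "0 < \<epsilon>"
    and inside: "\<And>x. norm x < \<rho> \<Longrightarrow> v (x, 0) \<le> ereal (A * (\<rho>\<^sup>2 - (norm x)\<^sup>2) powr - \<alpha> + k)"
  obtains k' where "\<And>t. 0 \<le> t \<Longrightarrow> 2 * N * t < \<rho>\<^sup>2 \<Longrightarrow>
    v (0, t) \<le> ereal ((1 + \<epsilon>) * A * (\<rho>\<^sup>2 - 2 * N * t) powr - \<alpha> + k')"
proof -
  define v' where "v' = (\<lambda>z. - v z)"
  have v': "extended_mcf v'" using extended_mcf_uminus[OF v] by (simp add: v'_def)
  have N: "1 \<le> N" using n by (simp add: N_def)
  have "0 < \<alpha> * A" "1 \<le> \<alpha> + 1" using \<alpha> A by auto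
  from blowup_inequality[OF this \<epsilon> \<rho>] obtain c K where c: "0 < c" and K: "0 < K" and ineq:
    "\<And>r y P. \<lbrakk>0 < r; 0 < y; y + r\<^sup>2 \<le> \<rho>\<^sup>2; P = 2 * r * (\<alpha> * A) * y powr - (\<alpha> + 1)\<rbrakk> \<Longrightarrow>
      P * (1 + 2 * (\<alpha> + 1) * r\<^sup>2 / y) / (1 + (P - c)\<^sup>2)
      < c + 2 * \<epsilon> * r * (\<alpha> * A) * (y + r\<^sup>2) powr - (\<alpha> + 1) + K * r" by metis
  define k1 where "k1 = k + c * \<rho> + 1"
  define k' where "k' = K * (\<rho>\<^sup>2 / (2 * N)) + k1"
  have fin: "- \<infinity> < v' (x, t)" if "0 \<le> t" "(norm x)\<^sup>2 + 2 * N * t < \<rho>\<^sup>2" for x t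
  proof (rule flow_avoids_minus_infinity[OF v' n N_def _ \<rho> that])
    fix R assume R: "0 < R" "R < \<rho>"
    define M where "M = A * (\<rho>\<^sup>2 - R\<^sup>2) powr - \<alpha> + k"
    have "ereal (- M - 1) < v' (x, 0)" if x: "norm x \<le> R" for x
    proof -
      have "R\<^sup>2 < \<rho>\<^sup>2" "(norm x)\<^sup>2 \<le> R\<^sup>2" using R x by (auto intro: power_mono power_strict_mono)
      then have "(\<rho>\<^sup>2 - (norm x)\<^sup>2) powr - \<alpha> \<le> (\<rho>\<^sup>2 - R\<^sup>2) powr - \<alpha>"
        using \<alpha> by (intro powr_mono2') auto
      then have "A * (\<rho>\<^sup>2 - (norm x)\<^sup>2) powr - \<alpha> + k \<le> M" using A by (simp add: M_def)
      moreover have "v (x, 0) \<le> ereal (A * (\<rho>\<^sup>2 - (norm x)\<^sup>2) powr - \<alpha> + k)" using x R by (intro inside) simp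
      ultimately have "v (x, 0) \<le> ereal M" by (meson ereal_less_eq(3) order_trans)
      also have "\<dots> < ereal (M + 1)" by simp
      finally have "- ereal (M + 1) < v' (x, 0)" unfolding v'_def ereal_minus_less_minus .
      then show ?thesis by simp
    qed
    then show "\<exists>M. \<forall>x. norm x \<le> R \<longrightarrow> ereal M < v' (x, 0)" by blast
  qed
  have bound: "v (0, t) \<le> ereal ((1 + \<epsilon>) * A * (R\<^sup>2 - 2 * N * t) powr - \<alpha> + k')"
    if t: "0 \<le> t" and R: "0 < R" "R < \<rho>" and \<tau>: "2 * N * t < R\<^sup>2" for R t
  proof -
    have R2: "R\<^sup>2 < \<rho>\<^sup>2" using R by (simp add: power_strict_mono)
    define Q where "Q = {z :: (real^'n) \<times> real. 0 \<le> snd z \<and> (norm (fst z - 0))\<^sup>2 + 2 * N * snd z \<le> R\<^sup>2}"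
    have "\<exists>z0\<in>Q. \<forall>z\<in>Q. v' z0 \<le> v' z"
    proof (rule continuous_attains_inf)
      show "compact Q" unfolding Q_def using N by (intro compact_parabolic_cap) simp
      have "(0, 0) \<in> Q" by (simp add: Q_def)
      then show "Q \<noteq> {}" by blast
      show "continuous_on Q v'"
        using v' unfolding extended_mcf_def by (rule continuous_on_subset[OF conjunct1]) (auto simp: Q_def)
    qed
    then obtain z0 where z0: "z0 \<in> Q" "\<And>z. z \<in> Q \<Longrightarrow> v' z0 \<le> v' z" by blast
    have "- \<infinity> < v' (fst z0, snd z0)" using z0(1) R2 by (intro fin) (auto simp: Q_def)
    then obtain M where M: "- \<infinity> < ereal (- M)" "ereal (- M) < v' z0"
      by (metis ereal_dense2 prod.collapse minus_minus)
    have *: "ereal (c * norm (0::real^'n) - A * (R\<^sup>2 - (norm (0::real^'n))\<^sup>2 - 2 * N * t) powr - \<alpha>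
        - \<epsilon> * A * (R\<^sup>2 - 2 * N * t) powr - \<alpha> - K * t - k1) < v' (0, t)"
    proof (rule blowup_barrier[OF v' n N_def A \<alpha> \<epsilon> R(1) c K])
      show "P * (1 + 2 * (\<alpha> + 1) * r\<^sup>2 / y) / (1 + (P - c)\<^sup>2)
          < c + 2 * \<epsilon> * r * (\<alpha> * A) * (y + r\<^sup>2) powr - (\<alpha> + 1) + K * r"
        if "0 < r" "0 < y" "y + r\<^sup>2 \<le> R\<^sup>2" "P = 2 * r * (\<alpha> * A) * y powr - (\<alpha> + 1)" for r y P
        using that R2 by (intro ineq) auto
      show "ereal (- M) < v' (x, t)" if "0 \<le> t" "(norm x)\<^sup>2 + 2 * N * t \<le> R\<^sup>2" for x t
        using M(2) z0(2)[of "(x, t)"] that by (auto simp: Q_def)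
      show "ereal (c * norm x - A * (R\<^sup>2 - (norm x)\<^sup>2) powr - \<alpha> - k1) < v' (x, 0)" if x: "norm x < R" for x
      proof -
        have "(norm x)\<^sup>2 < R\<^sup>2" using x by (simp add: power_strict_mono)
        then have "(\<rho>\<^sup>2 - (norm x)\<^sup>2) powr - \<alpha> \<le> (R\<^sup>2 - (norm x)\<^sup>2) powr - \<alpha>"
          using \<alpha> R2 by (intro powr_mono2') auto
        then have "A * (\<rho>\<^sup>2 - (norm x)\<^sup>2) powr - \<alpha> \<le> A * (R\<^sup>2 - (norm x)\<^sup>2) powr - \<alpha>" using A by simp
        moreover have "c * norm x \<le> c * \<rho>" using x R c by simp
        ultimately have "A * (\<rho>\<^sup>2 - (norm x)\<^sup>2) powr - \<alpha> + k
            < - (c * norm x - A * (R\<^sup>2 - (norm x)\<^sup>2) powr - \<alpha> - k1)" by (simp add: k1_def)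
        moreover have "v (x, 0) \<le> ereal (A * (\<rho>\<^sup>2 - (norm x)\<^sup>2) powr - \<alpha> + k)" using x R by (intro inside) simp
        ultimately have "v (x, 0) < ereal (- (c * norm x - A * (R\<^sup>2 - (norm x)\<^sup>2) powr - \<alpha> - k1))"
          by (meson ereal_less(1) ereal_less_eq(3) le_less_trans less_ereal.simps(1))
        then have "- ereal (- (c * norm x - A * (R\<^sup>2 - (norm x)\<^sup>2) powr - \<alpha> - k1)) < - v (x, 0)"
          unfolding ereal_minus_less_minus .
        then show ?thesis by (simp add: v'_def)
      qed
    qed (use t \<tau> in auto)
    have "ereal (- ((1 + \<epsilon>) * A * (R\<^sup>2 - 2 * N * t) powr - \<alpha> + K * t + k1)) < - v (0, t)"
    proof -
      have "c * norm (0::real^'n) - A * (R\<^sup>2 - (norm (0::real^'n))\<^sup>2 - 2 * N * t) powr - \<alpha>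
          - \<epsilon> * A * (R\<^sup>2 - 2 * N * t) powr - \<alpha> - K * t - k1
        = - ((1 + \<epsilon>) * A * (R\<^sup>2 - 2 * N * t) powr - \<alpha> + K * t + k1)"
        by (simp add: algebra_simps)
      with * show ?thesis unfolding v'_def by (simp only:)
    qed
    then have "- ereal ((1 + \<epsilon>) * A * (R\<^sup>2 - 2 * N * t) powr - \<alpha> + K * t + k1) < - v (0, t)" by simp
    then have "v (0, t) < ereal ((1 + \<epsilon>) * A * (R\<^sup>2 - 2 * N * t) powr - \<alpha> + K * t + k1)"
      unfolding ereal_minus_less_minus .
    moreover have "K * t \<le> K * (\<rho>\<^sup>2 / (2 * N))"
      using K \<tau> R2 N by (intro mult_left_mono) (auto simp: field_simps)
    then have "ereal ((1 + \<epsilon>) * A * (R\<^sup>2 - 2 * N * t) powr - \<alpha> + K * t + k1)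
        \<le> ereal ((1 + \<epsilon>) * A * (R\<^sup>2 - 2 * N * t) powr - \<alpha> + k')" by (simp add: k'_def)
    ultimately show ?thesis by (meson less_imp_le order_trans)
  qed
  show ?thesis
  proof (rule that[of k'])
    fix t assume t: "0 \<le> t" and \<tau>: "2 * N * t < \<rho>\<^sup>2"
    define f where "f R = (1 + \<epsilon>) * A * (R\<^sup>2 - 2 * N * t) powr - \<alpha> + k'" for R
    have "(f \<longlongrightarrow> f \<rho>) (at_left \<rho>)"
      unfolding f_def using \<tau> by (intro tendsto_intros) auto
    then have "((\<lambda>R. ereal (f R)) \<longlongrightarrow> ereal (f \<rho>)) (at_left \<rho>)" by (rule tendsto_ereal)
    moreover have "\<forall>\<^sub>F R in at_left \<rho>. sqrt (2 * N * t) < R \<and> R < \<rho>"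
      using \<tau> \<rho> by (intro eventually_at_left_Ico real_less_lsqrt) auto
    then have "\<forall>\<^sub>F R in at_left \<rho>. v (0, t) \<le> ereal (f R)"
    proof eventually_elim
      case (elim R)
      have "0 \<le> sqrt (2 * N * t)" using N t by simp
      with elim have R: "0 < R" by linarith
      moreover have "(sqrt (2 * N * t))\<^sup>2 < R\<^sup>2" using elim N t by (intro power_strict_mono) auto
      then have "2 * N * t < R\<^sup>2" using N t by simp
      ultimately show ?case unfolding f_def using elim t by (intro bound) auto
    qed
    ultimately show "v (0, t) \<le> ereal ((1 + \<epsilon>) * A * (\<rho>\<^sup>2 - 2 * N * t) powr - \<alpha> + k')"
      unfolding f_def[symmetric] by (rule tendsto_lowerbound) simp
  qed
qed

theorem theorem12:
  fixes u0 :: "real^'n \<Rightarrow> real"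
    and u :: "(real^'n) \<times> real \<Rightarrow> real"
    and \<Omega> :: "((real^'n) \<times> real) set"
    and \<rho> \<alpha> C T :: real
  assumes "CARD('n) \<ge> 2" and "\<rho> > 0"
    and "smooth_on (ball 0 \<rho>) u0"
    and "\<alpha> > 1" and "C > 0"
    and "u0 \<sim>[filtercomap norm (at_left \<rho>)] (\<lambda>x. C * (\<rho> - norm x) powr (-\<alpha>))"
    and "mcf_without_singularities u0 (ball 0 \<rho>) u \<Omega>"
    and "T = \<rho>\<^sup>2 / (2 * (real CARD('n) - 1))"
  shows "(\<forall>\<^sub>F t in at_left T. (0, t) \<in> \<Omega>) \<and>
    (\<lambda>t. u (0, t)) \<sim>[at_left T]
      (\<lambda>t. C * (\<rho> - sqrt (2 * (real CARD('n) - 1) * t)) powr (-\<alpha>)) \<and>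
    (\<lambda>t. C * (\<rho> - sqrt (2 * (real CARD('n) - 1) * t)) powr (-\<alpha>)) \<sim>[at_left T]
      (\<lambda>t. C * ((real CARD('n) - 1) / \<rho> * (T - t)) powr (-\<alpha>))"
proof -
  note n = assms(1) and \<rho> = assms(2) and C = assms(5)
  have \<alpha>: "0 < \<alpha>" using assms(4) by simp
  define N where "N = real CARD('n) - 1"
  have N: "1 \<le> N" using n by (simp add: N_def)
  define A where "A = C * (2 * \<rho>) powr \<alpha>"
  have A: "0 < A" using C \<rho> by (simp add: A_def)
  define g where "g t = A * (\<rho>\<^sup>2 - 2 * N * t) powr - \<alpha>" for t
  have T: "2 * N * T = \<rho>\<^sup>2" and T0: "0 < T" using N \<rho> by (simp_all add: assms(8) N_def[symmetric])
  have ev: "\<forall>\<^sub>F t in at_left T. 0 < t \<and> t < T" using T0 by (rule eventually_at_left_Ico)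
  have \<tau>: "2 * N * t < \<rho>\<^sup>2" if "t < T" for t using that N by (simp add: T[symmetric])
  obtain v where v: "extended_mcf v" and v0: "\<And>x. x \<in> ball 0 \<rho> \<Longrightarrow> v (x, 0) = ereal (u0 x)"
    and vinf: "\<And>x. x \<notin> ball 0 \<rho> \<Longrightarrow> \<bar>v (x, 0)\<bar> = \<infinity>"
    and vu: "\<And>x t. 0 \<le> t \<Longrightarrow> \<bar>v (x, t)\<bar> \<noteq> \<infinity> \<Longrightarrow> (x, t) \<in> \<Omega> \<and> v (x, t) = ereal (u (x, t))"
    using mcf_extension[OF assms(7)] by metis
  have "Ck_on 0 (ball 0 \<rho>) u0" using assms(3) unfolding smooth_on_def by blast
  then have cont: "continuous_on (ball 0 \<rho>) u0" by simp
  have "(\<lambda>x. C * (\<rho> - norm x) powr - \<alpha>) \<sim>[filtercomap norm (at_left \<rho>)]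
      (\<lambda>x. A * (\<rho>\<^sup>2 - (norm (x::real^'n))\<^sup>2) powr - \<alpha>)"
    unfolding A_def
    by (rule asymp_equiv_compose'[OF asymp_equiv_blowup_profiles[OF \<rho>] filterlim_filtercomap])
  with assms(6) have u0: "u0 \<sim>[filtercomap norm (at_left \<rho>)] (\<lambda>x. A * (\<rho>\<^sup>2 - (norm x)\<^sup>2) powr - \<alpha>)"
    by (rule asymp_equiv_trans)
  note data = blowup_data_bounds[OF \<rho> A cont u0]
  have outside: "v (x, 0) = \<infinity>" if "\<rho> \<le> norm x" for x
  proof -
    obtain k where k: "\<And>x. norm x < \<rho> \<Longrightarrow> \<bar>u0 x - A * (\<rho>\<^sup>2 - (norm x)\<^sup>2) powr - \<alpha>\<bar>
        \<le> 1 * A * (\<rho>\<^sup>2 - (norm x)\<^sup>2) powr - \<alpha> + k" by (rule data[OF zero_less_one]) blast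
    have "continuous_on UNIV (\<lambda>x. v (x, 0))"
    proof (rule continuous_on_compose2[where t = "UNIV \<times> {0..}" and g = v])
      show "continuous_on (UNIV \<times> {0..}) v" using v by (simp add: extended_mcf_def)
      show "continuous_on UNIV (\<lambda>x::real^'n. (x, 0::real))" by (intro continuous_intros)
    qed auto
    then show ?thesis
    proof (rule infinite_outside_ball[OF n \<rho>])
      show "ereal (- k) \<le> v (x, 0)" if "x \<in> ball 0 \<rho>" for x
        using k[of x] that by (simp add: v0)
    qed (use vinf that in auto)
  qed
  have bounds: "\<exists>k. \<forall>t. 0 \<le> t \<longrightarrow> t < T \<longrightarrow> (0, t) \<in> \<Omega> \<and> \<bar>u (0, t) - g t\<bar> \<le> \<epsilon> * g t + k"
    if \<epsilon>: "0 < \<epsilon>" "\<epsilon> < 1" for \<epsilon>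
  proof -
    \<comment> \<open>The factor \<open>1 + e\<close> is lost twice, in the initial data and in the barrier.\<close>
    define e where "e = \<epsilon> / 3"
    have e: "0 < e" "e < 1" "(1 + e) * (1 + e) \<le> 1 + \<epsilon>"
    proof -
      have "\<epsilon> * \<epsilon> \<le> \<epsilon>" using \<epsilon> by (simp add: mult_le_cancel_left1)
      moreover have "(1 + e) * (1 + e) = 1 + 2 * \<epsilon> / 3 + \<epsilon> * \<epsilon> / 9"
        by (simp add: e_def algebra_simps)
      ultimately show "(1 + e) * (1 + e) \<le> 1 + \<epsilon>" using \<epsilon> by linarith
    qed (use \<epsilon> in \<open>auto simp: e_def\<close>)
    obtain k where k: "\<And>x. norm x < \<rho> \<Longrightarrow> \<bar>u0 x - A * (\<rho>\<^sup>2 - (norm x)\<^sup>2) powr - \<alpha>\<bar>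
        \<le> e * A * (\<rho>\<^sup>2 - (norm x)\<^sup>2) powr - \<alpha> + k" by (rule data[OF e(1)]) blast
    have lower: "ereal ((1 - e) * A * (\<rho>\<^sup>2 - 2 * N * t) powr - \<alpha> - k - 1) < v (0, t)" if "0 \<le> t" "t < T" for t
    proof (rule flow_lower_bound[OF v n N_def \<rho> _ \<alpha> _ outside that(1) \<tau>[OF that(2)]])
      show "0 < (1 - e) * A" using e A by simp
      show "ereal ((1 - e) * A * (\<rho>\<^sup>2 - (norm x)\<^sup>2) powr - \<alpha> - k) \<le> v (x, 0)" if "norm x < \<rho>" for x
        using k[OF that] that by (simp add: v0 abs_le_iff algebra_simps)
    qed
    obtain k' where upper: "\<And>t. 0 \<le> t \<Longrightarrow> 2 * N * t < \<rho>\<^sup>2 \<Longrightarrow>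
        v (0, t) \<le> ereal ((1 + e) * ((1 + e) * A) * (\<rho>\<^sup>2 - 2 * N * t) powr - \<alpha> + k')"
    proof (rule flow_upper_bound[OF v n N_def \<rho> _ \<alpha> e(1)])
      show "0 < (1 + e) * A" using e A by simp
      show "v (x, 0) \<le> ereal ((1 + e) * A * (\<rho>\<^sup>2 - (norm x)\<^sup>2) powr - \<alpha> + k)" if "norm x < \<rho>" for x
        using k[OF that] that by (simp add: v0 abs_le_iff algebra_simps)
    qed blast
    have "(0, t) \<in> \<Omega> \<and> \<bar>u (0, t) - g t\<bar> \<le> \<epsilon> * g t + (\<bar>k\<bar> + 1 + \<bar>k'\<bar>)" if t: "0 \<le> t" "t < T" for t
    proof -
      note l = lower[OF t] and r = upper[OF t(1) \<tau>[OF t(2)]]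
      have "\<bar>v (0, t)\<bar> \<noteq> \<infinity>" using l r by auto
      from vu[OF t(1) this] have \<Omega>: "(0, t) \<in> \<Omega>" and vt: "v (0, t) = ereal (u (0, t))" by auto
      have g0: "0 < g t" using A \<tau>[OF t(2)] by (simp add: g_def)
      have "(1 - e) * g t - k - 1 < u (0, t)" using l by (simp add: vt g_def mult.assoc)
      moreover have "u (0, t) \<le> ((1 + e) * (1 + e)) * g t + k'" using r by (simp add: vt g_def mult.assoc)
      moreover have "((1 + e) * (1 + e)) * g t \<le> (1 + \<epsilon>) * g t" using e(3) g0 by (intro mult_right_mono) auto
      moreover have "(1 - \<epsilon>) * g t \<le> (1 - e) * g t" using \<epsilon> g0 by (intro mult_right_mono) (auto simp: e_def)
      ultimately have "\<bar>u (0, t) - g t\<bar> \<le> \<epsilon> * g t + (\<bar>k\<bar> + 1 + \<bar>k'\<bar>)"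
        unfolding distrib_right left_diff_distrib by linarith
      with \<Omega> show ?thesis by simp
    qed
    then show ?thesis by blast
  qed
  have "\<forall>\<^sub>F t in at_left T. (0, t) \<in> \<Omega>"
    using bounds[of "1 / 2"] ev by (auto elim: eventually_mono)
  moreover have ug: "(\<lambda>t. u (0, t)) \<sim>[at_left T] g"
  proof (rule asymp_equiv_of_relative_bounds)
    have lim: "((\<lambda>t. \<rho>\<^sup>2 - 2 * N * t) \<longlongrightarrow> 0) (at_left T)"
      using T by (auto intro!: tendsto_eq_intros)
    have "filterlim (\<lambda>t. (\<rho>\<^sup>2 - 2 * N * t) powr - \<alpha>) at_top (at_left T)"
      unfolding filterlim_at_top_gt[of _ _ 0]
    proof (intro allI impI)
      fix Z :: real assume Z: "0 < Z"
      then have "\<forall>\<^sub>F t in at_left T. \<rho>\<^sup>2 - 2 * N * t < Z powr (- 1 / \<alpha>)"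
        by (intro order_tendstoD(2)[OF lim]) simp
      with ev show "\<forall>\<^sub>F t in at_left T. Z \<le> (\<rho>\<^sup>2 - 2 * N * t) powr - \<alpha>"
      proof eventually_elim
        case (elim t)
        then have "(Z powr (- 1 / \<alpha>)) powr - \<alpha> \<le> (\<rho>\<^sup>2 - 2 * N * t) powr - \<alpha>"
          using \<alpha> \<tau>[of t] by (intro powr_mono2') auto
        then show ?case using \<alpha> Z by (simp add: powr_powr)
      qed
    qed
    then show "filterlim g at_top (at_left T)"
      unfolding g_def using A by (intro filterlim_tendsto_pos_mult_at_top[OF tendsto_const])
    show "\<exists>k. \<forall>\<^sub>F t in at_left T. \<bar>u (0, t) - g t\<bar> \<le> \<epsilon> * g t + k" if "0 < \<epsilon>" "\<epsilon> < 1" for \<epsilon>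
    proof -
      from bounds[OF that] obtain k
        where k: "\<And>t. 0 \<le> t \<Longrightarrow> t < T \<Longrightarrow> \<bar>u (0, t) - g t\<bar> \<le> \<epsilon> * g t + k" by blast
      have "\<forall>\<^sub>F t in at_left T. \<bar>u (0, t) - g t\<bar> \<le> \<epsilon> * g t + k"
        using ev by eventually_elim (simp add: k)
      then show ?thesis ..
    qed
  qed
  moreover have g1: "(\<lambda>t. C * (\<rho> - sqrt (2 * N * t)) powr - \<alpha>) \<sim>[at_left T] g"
  proof -
    have "((\<lambda>t. sqrt (2 * N * t)) \<longlongrightarrow> \<rho>) (at_left T)"
      using T \<rho> by (auto intro!: tendsto_eq_intros)
    moreover have "\<forall>\<^sub>F t in at_left T. sqrt (2 * N * t) < \<rho>"
      using ev by eventually_elim (use \<tau> \<rho> in \<open>auto intro: real_less_lsqrt\<close>)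
    ultimately have "filterlim (\<lambda>t. sqrt (2 * N * t)) (at_left \<rho>) (at_left T)"
      by (auto simp: filterlim_at elim: eventually_mono)
    from asymp_equiv_compose'[OF asymp_equiv_blowup_profiles[OF \<rho>] this, of C \<alpha>]
    have "(\<lambda>t. C * (\<rho> - sqrt (2 * N * t)) powr - \<alpha>) \<sim>[at_left T] (\<lambda>t. A * (\<rho>\<^sup>2 - (sqrt (2 * N * t))\<^sup>2) powr - \<alpha>)"
      by (simp add: A_def)
    moreover have "\<forall>\<^sub>F t in at_left T. A * (\<rho>\<^sup>2 - (sqrt (2 * N * t))\<^sup>2) powr - \<alpha> = g t"
      using ev by eventually_elim (use N in \<open>simp add: g_def\<close>)
    ultimately show ?thesis
      using asymp_equiv_cong[OF always_eventually, of "\<lambda>t. C * (\<rho> - sqrt (2 * N * t)) powr - \<alpha>"] by fastforce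
  qed
  moreover have g2: "g \<sim>[at_left T] (\<lambda>t. C * (N / \<rho> * (T - t)) powr - \<alpha>)"
  proof -
    have "\<forall>\<^sub>F t in at_left T. g t = C * (N / \<rho> * (T - t)) powr - \<alpha>"
      using ev
    proof eventually_elim
      case (elim t)
      have "\<rho>\<^sup>2 - 2 * N * t = (2 * \<rho>) * (N / \<rho> * (T - t))"
        using \<rho> unfolding T[symmetric] by (simp add: field_simps)
      moreover have "0 \<le> N / \<rho> * (T - t)" using elim N \<rho> by simp
      ultimately have "(\<rho>\<^sup>2 - 2 * N * t) powr - \<alpha> = (2 * \<rho>) powr - \<alpha> * (N / \<rho> * (T - t)) powr - \<alpha>"
        using \<rho> by (simp only: powr_mult)
      moreover have "(2 * \<rho>) powr \<alpha> * (2 * \<rho>) powr - \<alpha> = 1" using \<rho> by (simp add: powr_minus)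
      ultimately show ?case by (simp add: g_def A_def mult.assoc mult.left_commute)
    qed
    then show ?thesis by (rule asymp_equiv_refl_ev)
  qed
  ultimately show ?thesis
    unfolding N_def[symmetric]
    by (auto intro: asymp_equiv_trans asymp_equiv_symI)
qed

end
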